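(* Let $d \in \{5,6\}$. Then Fuglede's conjecture holds in $\mathbb{Z}_2^d$: a nonempty subset $E \subseteq \mathbb{Z}_2^d$ is spectral if and only if it is a tile.
   Context: $\mathbb{Z}_2 = \mathbb{Z}/2\mathbb{Z}$, and for $b,x \in \mathbb{Z}_2^d$, $b\cdot x = \sum_{i=1}^d b_i x_i \in \mathbb{Z}_2$. For $b\in\mathbb{Z}_2^d$, the exponential corresponding to $b$ is the function $x \mapsto (-1)^{b\cdot x}$ on $\mathbb{Z}_2^d$. A nonempty set $E \subseteq \mathbb{Z}_2^d$ is spectral if there is a set $B \subseteq \mathbb{Z}_2^d$ (a spectrum of $E$) such that the exponentials corresponding to elements of $B$, restricted to $E$, form an orthogonal basis of $L^2(E)$ (functions $E \to \mathbb{C}$ with counting measure); equivalently, $|B| = |E|$ and $\sum_{x\in E} (-1)^{(b-b')\cdot x} = 0$ for all distinct $b,b' \in B$. The set $E$ is a tile if there is a set $A \subseteq \mathbb{Z}_2^d$ such that every element of $\mathbb{Z}_2^d$ can be written uniquely as $e + a$ with $e\in E$, $a \in A$. *)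

theory Defs
  imports "HOL-Analysis.Analysis" "HOL-Library.Z2"
begin

text \<open>
  The field \<open>\<int>\<^sub>2\<close> is the library type \<^typ>\<open>bit\<close>, and \<open>\<int>\<^sub>2\<^sup>d\<close> is \<open>bit ^ 'd\<close> with \<open>d = CARD('d)\<close>.
\<close>

instance bit :: finite
proof
  have "(UNIV :: bit set) = {0, 1}"
    by (auto intro: bit.exhaust)
  then show "finite (UNIV :: bit set)"
    by (metis finite.emptyI finite.insertI)
qed

definition dot_bit :: "bit ^ 'd \<Rightarrow> bit ^ 'd \<Rightarrow> bit"
  where "dot_bit b x = (\<Sum>i\<in>UNIV. b $ i * x $ i)"

definition exponential :: "bit ^ 'd \<Rightarrow> bit ^ 'd \<Rightarrow> complex"
  where "exponential b x = (- 1) ^ (of_bit (dot_bit b x) :: nat)"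

definition inner_on :: "'a set \<Rightarrow> ('a \<Rightarrow> complex) \<Rightarrow> ('a \<Rightarrow> complex) \<Rightarrow> complex"
  where "inner_on E f g = (\<Sum>x\<in>E. f x * cnj (g x))"

text \<open>
  For finite \<open>E\<close> and \<open>B\<close>: the family of restrictions to \<open>E\<close> of \<open>\<phi> b\<close>, for \<open>b \<in> B\<close>, is an orthogonal
  basis of \<open>L\<^sup>2(E)\<close>. Elements of \<open>L\<^sup>2(E)\<close> are represented by functions on the whole type, of which
  only the values on \<open>E\<close> matter; the coefficient function is extensional so that it can be unique.
\<close>

definition orthogonal_basis_on :: "'a set \<Rightarrow> 'b set \<Rightarrow> ('b \<Rightarrow> 'a \<Rightarrow> complex) \<Rightarrow> bool"
  where "orthogonal_basis_on E B \<phi> \<longleftrightarrow>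
    (\<forall>b\<in>B. \<forall>b'\<in>B. b \<noteq> b' \<longrightarrow> inner_on E (\<phi> b) (\<phi> b') = 0) \<and>
    (\<forall>f. \<exists>!c. c \<in> B \<rightarrow>\<^sub>E (UNIV :: complex set) \<and> (\<forall>x\<in>E. f x = (\<Sum>b\<in>B. c b * \<phi> b x)))"

definition spectral :: "(bit ^ 'd) set \<Rightarrow> bool"
  where "spectral E \<longleftrightarrow> (\<exists>B. orthogonal_basis_on E B exponential)"

definition is_tile :: "(bit ^ 'd) set \<Rightarrow> bool"
  where "is_tile E \<longleftrightarrow> (\<exists>A. \<forall>x. \<exists>!(e, a). e \<in> E \<and> a \<in> A \<and> x = e + a)"

lemma exponential_cnj_mult:
  "exponential b x * cnj (exponential b' x) = exponential (b - b') x"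
proof -
  have d: "dot_bit (b - b') x = dot_bit b x - dot_bit b' x"
    by (simp only: dot_bit_def vector_minus_component left_diff_distrib sum_subtractf)
  show ?thesis
    unfolding exponential_def d
    by (cases "dot_bit b x"; cases "dot_bit b' x") simp_all
qed

lemma exponential_norm: "exponential b x * cnj (exponential b x) = 1"
  by (simp add: exponential_cnj_mult) (simp add: exponential_def dot_bit_def)

lemma spectral_iff:
  fixes E :: "(bit ^ 'd) set"
  assumes ne: "E \<noteq> {}"
  shows "spectral E \<longleftrightarrow>
    (\<exists>B. card B = card E \<and>
      (\<forall>b\<in>B. \<forall>b'\<in>B. b \<noteq> b' \<longrightarrow> (\<Sum>x\<in>E. exponential (b - b') x) = 0))"
proof -
  have fin: "finite S" for S :: "(bit ^ 'd) set"
    by (rule finite_subset[OF subset_UNIV finite_class.finite_UNIV])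
  let ?n = "of_nat (card E) :: complex"
  have n0: "?n \<noteq> 0"
    using ne fin by simp
  have inner: "inner_on E (exponential b) (exponential b') = (\<Sum>x\<in>E. exponential (b - b') x)"
    for b b' :: "bit ^ 'd"
    by (simp only: inner_on_def exponential_cnj_mult)
  have inner_same: "inner_on E (exponential b) (exponential b) = ?n" for b :: "bit ^ 'd"
    by (simp add: inner_on_def exponential_norm)
  define orth where "orth = (\<lambda>B. \<forall>b\<in>B. \<forall>b'\<in>B. b \<noteq> b' \<longrightarrow>
    inner_on E (exponential b) (exponential b' :: bit ^ 'd \<Rightarrow> complex) = 0)"
  have coeff: "c b = inner_on E f (exponential b) / ?n"
    if o: "orth B" and b: "b \<in> B" and f: "\<forall>x\<in>E. f x = (\<Sum>b\<in>B. c b * exponential b x)"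
    for B c b f
  proof -
    have "inner_on E f (exponential b) =
        (\<Sum>x\<in>E. \<Sum>b'\<in>B. c b' * (exponential b' x * cnj (exponential b x)))"
      unfolding inner_on_def using f by (intro sum.cong) (simp_all add: sum_distrib_right mult.assoc)
    also have "\<dots> = (\<Sum>b'\<in>B. c b' * inner_on E (exponential b') (exponential b))"
      by (subst sum.swap) (simp add: inner_on_def sum_distrib_left)
    also have "\<dots> = (\<Sum>b'\<in>B. if b' = b then c b * ?n else 0)"
      using o b by (intro sum.cong) (auto simp: orth_def inner_same)
    also have "\<dots> = c b * ?n"
      using b fin by simp
    finally show ?thesis
      using n0 by simp
  qed
  have "orthogonal_basis_on E B exponential \<longleftrightarrow> orth B \<and> card B = card E" for B
  proof
    assume ob: "orthogonal_basis_on E B exponential"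
    then have o: "orth B"
      by (simp add: orthogonal_basis_on_def orth_def)
    from ne obtain y where y: "y \<in> E"
      by blast
    define f where "f x = (if x = y then 1 else 0 :: complex)" for x
    from ob obtain c where c: "\<forall>x\<in>E. f x = (\<Sum>b\<in>B. c b * exponential b x)"
      unfolding orthogonal_basis_on_def by blast
    have "inner_on E f (exponential b) = (\<Sum>x\<in>E. if x = y then cnj (exponential b y) else 0)" for b
      unfolding inner_on_def by (intro sum.cong) (simp_all add: f_def)
    then have "inner_on E f (exponential b) = cnj (exponential b y)" for b
      using y fin by simp
    then have cb: "c b = cnj (exponential b y) / ?n" if "b \<in> B" for b
      using coeff[OF o that c] by simp
    have "1 = (\<Sum>b\<in>B. c b * exponential b y)"
      using bspec[OF c y] by (simp only: f_def) simp
    also have "\<dots> = (\<Sum>b\<in>B. 1 / ?n)"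
      using cb exponential_norm[of _ y]
      by (intro sum.cong) (simp_all add: mult.commute)
    also have "\<dots> = of_nat (card B) / ?n"
      by simp
    finally have "of_nat (card B) = ?n"
      using n0 by (simp add: field_simps)
    with o show "orth B \<and> card B = card E"
      by simp
  next
    assume A: "orth B \<and> card B = card E"
    then have o: "orth B" and card: "card B = card E"
      by auto
    define K where "K x y = (\<Sum>b\<in>B. exponential b x * cnj (exponential b y)) / ?n" for x y
    have cnj_exp: "cnj (exponential b x) = exponential b x" for b x :: "bit ^ 'd"
      by (simp add: exponential_def)
    have K1: "K x x = 1" for x
      using n0 card by (simp add: K_def exponential_norm)
    have KK: "(\<Sum>x\<in>E. K x y * K x y) = 1" for y
    proof -
      have "(\<Sum>x\<in>E. K x y * K x y) =
          (\<Sum>x\<in>E. \<Sum>b\<in>B. \<Sum>b'\<in>B. exponential b y * exponential b' y *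
             (exponential b x * cnj (exponential b' x))) / (?n * ?n)"
        by (simp add: K_def cnj_exp sum_product sum_divide_distrib mult_ac)
      also have "(\<Sum>x\<in>E. \<Sum>b\<in>B. \<Sum>b'\<in>B. exponential b y * exponential b' y *
             (exponential b x * cnj (exponential b' x))) =
          (\<Sum>b\<in>B. \<Sum>b'\<in>B. exponential b y * exponential b' y *
             inner_on E (exponential b) (exponential b'))"
        by (subst sum.swap, rule sum.cong[OF refl], subst sum.swap)
          (simp add: inner_on_def sum_distrib_left)
      also have "\<dots> = (\<Sum>b\<in>B. \<Sum>b'\<in>B. if b' = b then ?n else 0)"
      proof (intro sum.cong refl)
        fix b b' assume "b \<in> B" "b' \<in> B"
        then show "exponential b y * exponential b' y * inner_on E (exponential b) (exponential b')
            = (if b' = b then ?n else 0)"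
          using o exponential_norm[of b y] by (auto simp: orth_def inner_same cnj_exp)
      qed
      also have "\<dots> = ?n * ?n"
        using card fin by simp
      finally show ?thesis
        using n0 by simp
    qed
    have K_real: "K x y \<in> \<real>" for x y
      unfolding K_def
      by (intro Reals_divide sum_in_Reals Reals_mult Reals_of_nat) (simp_all add: Reals_cnj_iff cnj_exp)
    have K0: "K x y = 0" if x: "x \<in> E" and y: "y \<in> E" and xy: "x \<noteq> y" for x y
    proof -
      define k where "k x = Re (K x y)" for x
      have Kk: "K x y = of_real (k x)" for x
        using K_real[of x y] by (simp add: k_def of_real_Re)
      have "of_real (\<Sum>x\<in>E. k x * k x) = (1 :: complex)"
        using KK[of y] by (simp add: Kk)
      then have "(\<Sum>x\<in>E. k x * k x) = 1"
        using of_real_eq_1_iff by blast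
      moreover have "k y = 1"
        using K1[of y] by (simp add: k_def)
      moreover have "(\<Sum>x\<in>E. k x * k x) = k y * k y + (\<Sum>x\<in>E - {y}. k x * k x)"
        using y fin by (simp add: sum.remove)
      ultimately have "(\<Sum>x\<in>E - {y}. k x * k x) = 0"
        by simp
      then have "k x * k x = 0"
        using x xy fin by (subst (asm) sum_nonneg_eq_0_iff) auto
      then show ?thesis
        by (simp add: Kk)
    qed
    show "orthogonal_basis_on E B exponential"
      unfolding orthogonal_basis_on_def
    proof (intro conjI allI)
      show "\<forall>b\<in>B. \<forall>b'\<in>B. b \<noteq> b' \<longrightarrow> inner_on E (exponential b) (exponential b') = 0"
        using o by (simp add: orth_def)
    next
      fix f :: "bit ^ 'd \<Rightarrow> complex"
      define c where "c = restrict (\<lambda>b. inner_on E f (exponential b) / ?n) B"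
      have rep: "f x = (\<Sum>b\<in>B. c b * exponential b x)" if x: "x \<in> E" for x
      proof -
        have "(\<Sum>b\<in>B. c b * exponential b x) =
            (\<Sum>b\<in>B. \<Sum>y\<in>E. f y * (exponential b x * cnj (exponential b y) / ?n))"
        proof (rule sum.cong[OF refl])
          fix b assume "b \<in> B"
          then have "c b = (\<Sum>y\<in>E. f y * cnj (exponential b y) / ?n)"
            by (simp add: c_def inner_on_def sum_divide_distrib)
          then have "c b * exponential b x =
              (\<Sum>y\<in>E. f y * cnj (exponential b y) / ?n * exponential b x)"
            by (simp only: sum_distrib_right)
          also have "\<dots> = (\<Sum>y\<in>E. f y * (exponential b x * cnj (exponential b y) / ?n))"
            by (rule sum.cong[OF refl]) (simp only: times_divide_eq_left times_divide_eq_right mult_ac)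
          finally show "c b * exponential b x =
              (\<Sum>y\<in>E. f y * (exponential b x * cnj (exponential b y) / ?n))" .
        qed
        also have "\<dots> = (\<Sum>y\<in>E. f y * K x y)"
          by (subst sum.swap) (simp add: K_def sum_distrib_left sum_divide_distrib)
        also have "\<dots> = (\<Sum>y\<in>E. if y = x then f x else 0)"
          using x by (intro sum.cong) (auto simp: K1 K0)
        finally show ?thesis
          using x fin by simp
      qed
      have cB: "c \<in> B \<rightarrow>\<^sub>E UNIV"
        by (simp add: c_def)
      have uniq: "c' = c"
        if "c' \<in> B \<rightarrow>\<^sub>E UNIV" "\<forall>x\<in>E. f x = (\<Sum>b\<in>B. c' b * exponential b x)" for c'
      proof
        fix b
        show "c' b = c b"
          using coeff[OF o _ that(2), of b] that(1) by (cases "b \<in> B") (auto simp: c_def PiE_def extensional_def)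
      qed
      show "\<exists>!c. c \<in> B \<rightarrow>\<^sub>E UNIV \<and> (\<forall>x\<in>E. f x = (\<Sum>b\<in>B. c b * exponential b x))"
      proof (rule ex1I[of _ c], intro conjI ballI)
        show "c \<in> B \<rightarrow>\<^sub>E UNIV"
          by (fact cB)
        show "f x = (\<Sum>b\<in>B. c b * exponential b x)" if "x \<in> E" for x
          using that by (rule rep)
        show "c' = c"
          if "c' \<in> B \<rightarrow>\<^sub>E UNIV \<and> (\<forall>x\<in>E. f x = (\<Sum>b\<in>B. c' b * exponential b x))" for c'
          by (rule uniq[OF conjunct1[OF that] conjunct2[OF that]])
      qed
    qed
  qed
  then show ?thesis
    unfolding spectral_def by (auto simp: orth_def inner)
qed

end

theory Submission
  imports Defs
begin

text \<open>
  Both properties are equivalent to \<open>E\<close> having a complementary subgroup \<open>H\<close>: then \<open>E \<oplus> H\<close> is a tiling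
  and the annihilator of \<open>H\<close> is a spectrum. Let \<open>N = 2\<^sup>d\<close> and \<open>n = |E|\<close>.

  If \<open>B\<close> is a spectrum of \<open>E\<close>, the transform of \<open>1\<^sub>B\<close> vanishes on the nonzero elements of \<open>E + E\<close>.
  Comparing both sides of \<open>1\<^sub>B\<^sup>2 = 1\<^sub>B\<close> on the Fourier side, either its support contains a subgroup of
  order 4, so that \<open>4 n \<le> N\<close>, or \<open>n\<close> is \<open>N\<close> or \<open>N / 2\<close>. Divisibility leaves only powers
  of 2 and \<open>n = 12\<close>; the latter is excluded since two of the 66 pairs in \<open>B\<close> have the same sum.
  For \<open>n \<le> 4\<close> a complement is found greedily, and for \<open>n = 8\<close> among the differences of \<open>B\<close>.

  If \<open>E \<oplus> A\<close> is a tiling, any subgroup contained in \<open>A + A\<close> meets \<open>E + E\<close> trivially, which settles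
  \<open>|A| \<le> 4\<close>. When \<open>|E| = |A| = 8\<close> and neither set lies in an affine hyperplane, the identity
  \<open>1\<^sub>A\<^sup>2 = 1\<^sub>A\<close> at a maximum of the transform of \<open>1\<^sub>A\<close> forces so many points in its support,
  where the transform of \<open>1\<^sub>E\<close> vanishes, that a subgroup of order 8 is a spectrum of \<open>E\<close>.
\<close>

subsection \<open>Characters\<close>

lemma bit_vec_add_self [simp]: "x + x = (0 :: bit ^ 'd)"
  by (simp add: vec_eq_iff)

lemma bit_vec_add_self_left [simp]: "x + (x + y) = (y :: bit ^ 'd)"
  by (simp flip: add.assoc)

lemma bit_vec_add_eq_0_iff [simp]: "x + y = 0 \<longleftrightarrow> x = (y :: bit ^ 'd)"
  by (metis bit_vec_add_self bit_vec_add_self_left add.right_neutral)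

lemma bit_vec_diff: "x - y = x + (y :: bit ^ 'd)"
  by (simp add: diff_eq_eq add.assoc)

lemmas bit_vec_ac = add.assoc add.commute add.left_commute

lemma card_bit: "CARD(bit) = 2"
proof -
  have "(UNIV :: bit set) = {0, 1}"
    by (auto intro: bit.exhaust)
  then show ?thesis
    by (metis card_2_iff zero_neq_one)
qed

lemma card_bit_vec: "CARD(bit ^ 'd) = 2 ^ CARD('d)"
  by (simp add: card_bit)

text \<open>Integer-valued counterpart of \<open>exponential\<close>, which lets divisibility
  arguments apply to the transform.\<close>

definition chi :: "bit ^ 'd \<Rightarrow> bit ^ 'd \<Rightarrow> int"
  where "chi b x = (if dot_bit b x = 0 then 1 else - 1)"

definition fourier :: "(bit ^ 'd) set \<Rightarrow> bit ^ 'd \<Rightarrow> int"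
  where "fourier S b = (\<Sum>x\<in>S. chi b x)"

lemma dot_bit_commute: "dot_bit b x = dot_bit x b"
  unfolding dot_bit_def by (rule sum.cong[OF refl], rule mult.commute)

lemma chi_commute: "chi b x = chi x b"
  by (simp add: chi_def dot_bit_commute)

lemma dot_bit_add_right: "dot_bit b (x + y) = dot_bit b x + dot_bit b y"
  by (simp only: dot_bit_def vector_add_component distrib_left sum.distrib)

lemma chi_add_right: "chi b (x + y) = chi b x * chi b y"
  unfolding chi_def dot_bit_add_right
  by (cases "dot_bit b x"; cases "dot_bit b y") simp_all

lemma chi_add_left: "chi (a + b) x = chi a x * chi b x"
  by (metis chi_add_right chi_commute)

lemma chi_0_right [simp]: "chi b 0 = 1"
  by (simp add: chi_def dot_bit_def)

lemma chi_0_left [simp]: "chi 0 x = 1"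
  by (simp add: chi_def dot_bit_def)

lemma chi_cases: "chi b x = 1 \<or> chi b x = - 1"
  by (simp add: chi_def)

lemma chi_square [simp]: "chi b x * chi b x = 1"
  by (simp add: chi_def)

lemma exponential_eq_chi: "exponential b x = of_int (chi b x)"
  unfolding exponential_def chi_def by (cases "dot_bit b x") simp_all

lemma separating_chi:
  fixes x :: "bit ^ 'd"
  assumes "x \<noteq> 0"
  obtains b where "chi b x = - 1"
proof -
  obtain i where i: "x $ i \<noteq> 0"
    using assms by (auto simp: vec_eq_iff)
  have "dot_bit (axis i 1) x = (\<Sum>j\<in>UNIV. if j = i then x $ i else 0)"
    unfolding dot_bit_def by (rule sum.cong) (auto simp: axis_def)
  then have "chi (axis i 1) x = - 1"
    using i by (simp add: chi_def)
  then show thesis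
    by (rule that)
qed

lemma sum_chi_subgroup:
  fixes H :: "(bit ^ 'd) set"
  assumes "\<And>x y. x \<in> H \<Longrightarrow> y \<in> H \<Longrightarrow> x + y \<in> H"
    and "h \<in> H" "chi b h = - 1"
  shows "(\<Sum>x\<in>H. chi b x) = 0"
proof -
  have "(\<Sum>x\<in>H. chi b x) = (\<Sum>x\<in>H. chi b (h + x))"
    by (rule sum.reindex_bij_witness[of _ "\<lambda>x. h + x" "\<lambda>x. h + x"]) (use assms in auto)
  also have "\<dots> = - (\<Sum>x\<in>H. chi b x)"
    using assms(3) by (simp add: chi_add_right sum_negf)
  finally show ?thesis
    by simp
qed

lemma sum_chi:
  fixes x :: "bit ^ 'd"
  shows "(\<Sum>b\<in>UNIV. chi b x) = (if x = 0 then int CARD(bit ^ 'd) else 0)"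
proof (cases "x = 0")
  case False
  then obtain b where "chi x b = - 1"
    using separating_chi chi_commute by metis
  then have "(\<Sum>b\<in>UNIV. chi x b) = 0"
    by (intro sum_chi_subgroup[of UNIV b]) auto
  with False show ?thesis
    by (simp add: chi_commute[of _ x])
qed simp

lemma fourier_0 [simp]: "fourier S 0 = int (card S)"
  by (simp add: fourier_def)

lemma abs_fourier_le: "\<bar>fourier S b\<bar> \<le> int (card S)"
proof -
  have "\<bar>fourier S b\<bar> \<le> (\<Sum>x\<in>S. \<bar>chi b x\<bar>)"
    unfolding fourier_def by (rule sum_abs)
  also have "\<dots> = (\<Sum>x\<in>S. 1)"
    by (rule sum.cong) (auto simp: chi_def)
  finally show ?thesis
    by simp
qed

text \<open>The transform of the identity \<open>1\<^sub>S\<^sup>2 = 1\<^sub>S\<close>.\<close>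

lemma fourier_convolution:
  fixes S :: "(bit ^ 'd) set"
  shows "(\<Sum>u\<in>UNIV. fourier S u * fourier S (u + h)) = int CARD(bit ^ 'd) * fourier S h"
proof -
  have "(\<Sum>u\<in>UNIV. fourier S u * fourier S (u + h))
      = (\<Sum>u\<in>UNIV. \<Sum>x\<in>S. \<Sum>y\<in>S. chi h y * chi u (x + y))"
    by (simp add: fourier_def sum_product chi_add_left chi_add_right mult_ac)
  also have "\<dots> = (\<Sum>x\<in>S. \<Sum>y\<in>S. chi h y * (\<Sum>u\<in>UNIV. chi u (x + y)))"
    by (subst sum.swap, rule sum.cong[OF refl], subst sum.swap) (simp add: sum_distrib_left)
  also have "\<dots> = (\<Sum>x\<in>S. \<Sum>y\<in>S. if y = x then chi h x * int CARD(bit ^ 'd) else 0)"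
    by (intro sum.cong refl) (auto simp: sum_chi)
  also have "\<dots> = int CARD(bit ^ 'd) * fourier S h"
    by (simp add: fourier_def mult.commute flip: sum_distrib_right)
  finally show ?thesis .
qed

text \<open>At \<open>h = 0\<close> the convolution identity is Parseval, and only the term
  \<open>u = 0\<close> survives: the square of \<open>card S\<close> equals N times
  \<open>card S\<close>.\<close>

lemma fourier_vanishing_imp_UNIV:
  fixes S :: "(bit ^ 'd) set"
  assumes "S \<noteq> {}" "\<And>h. h \<noteq> 0 \<Longrightarrow> fourier S h = 0"
  shows "S = UNIV"
proof -
  have "(\<Sum>u\<in>UNIV. fourier S u * fourier S (u + 0)) = (\<Sum>u\<in>(UNIV :: (bit ^ 'd) set). if u = 0 then int (card S) * int (card S) else 0)"
    by (intro sum.cong refl) (simp add: assms(2))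
  then have "int (card S) * int (card S) = int CARD(bit ^ 'd) * int (card S)"
    using fourier_convolution[of S 0] by simp
  then have "card S = CARD(bit ^ 'd)"
    using assms(1) by simp
  then show ?thesis
    by (simp add: card_eq_UNIV_imp_eq_UNIV)
qed

subsection \<open>Complementary subgroups\<close>

definition subgp :: "(bit ^ 'd) set \<Rightarrow> bool"
  where "subgp H \<longleftrightarrow> 0 \<in> H \<and> (\<forall>x\<in>H. \<forall>y\<in>H. x + y \<in> H)"

text \<open>In characteristic two this is also the difference set of \<open>E\<close>.\<close>

definition sumset :: "(bit ^ 'd) set \<Rightarrow> (bit ^ 'd) set"
  where "sumset E = {x + y | x y. x \<in> E \<and> y \<in> E}"

text \<open>The trivial intersection makes the translates of \<open>H\<close> by elements of
  \<open>E\<close> disjoint, so the bound on orders already forces a tiling.\<close>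

definition complemented :: "(bit ^ 'd) set \<Rightarrow> bool"
  where "complemented E \<longleftrightarrow>
    (\<exists>H. subgp H \<and> H \<inter> sumset E \<subseteq> {0} \<and> CARD(bit ^ 'd) \<le> card E * card H)"

lemma complementedI:
  fixes E H :: "(bit ^ 'd) set"
  assumes "subgp H" "\<And>x y. x \<in> E \<Longrightarrow> y \<in> E \<Longrightarrow> x + y \<in> H \<Longrightarrow> x = y"
    "CARD(bit ^ 'd) \<le> card E * card H"
  shows "complemented E"
  unfolding complemented_def
  by (rule exI[of _ H]) (use assms in \<open>auto simp: sumset_def\<close>)

lemma inj_on_add_packing:
  fixes E A :: "(bit ^ 'd) set"
  assumes "sumset A \<inter> sumset E \<subseteq> {0}"
  shows "inj_on (\<lambda>(e, a). e + a) (E \<times> A)"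
proof (rule inj_onI, clarsimp)
  fix e a e' a' assume *: "e \<in> E" "a \<in> A" "e' \<in> E" "a' \<in> A" "e + a = e' + a'"
  then have "e + e' = a + a'"
    by (metis add.commute add.left_commute bit_vec_add_self_left)
  moreover have "e + e' \<in> sumset E" "a + a' \<in> sumset A"
    using * unfolding sumset_def by blast+
  ultimately have "e + e' = 0"
    using assms by (metis IntI empty_iff insert_iff subsetD)
  then show "e = e' \<and> a = a'"
    using * by simp
qed

lemma sumset_subgp:
  assumes "subgp H"
  shows "sumset H = H"
  using assms unfolding subgp_def sumset_def by (auto, metis add.right_neutral)

lemma card_packing_le:
  fixes E A :: "(bit ^ 'd) set"
  assumes "sumset A \<inter> sumset E \<subseteq> {0}"
  shows "card E * card A \<le> CARD(bit ^ 'd)"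
  using card_image[OF inj_on_add_packing[OF assms]] card_mono[of UNIV "(\<lambda>(e, a). e + a) ` (E \<times> A)"]
  by (simp add: card_cartesian_product)

lemma packing_tiles:
  fixes E A :: "(bit ^ 'd) set"
  assumes "sumset A \<inter> sumset E \<subseteq> {0}" "CARD(bit ^ 'd) \<le> card E * card A"
  shows "bij_betw (\<lambda>(e, a). e + a) (E \<times> A) UNIV"
proof -
  have "card ((\<lambda>(e, a). e + a) ` (E \<times> A)) = CARD(bit ^ 'd)"
    using card_image[OF inj_on_add_packing[OF assms(1)]] assms(2) card_packing_le[OF assms(1)]
    by (simp add: card_cartesian_product)
  then show ?thesis
    using inj_on_add_packing[OF assms(1)] by (simp add: bij_betw_def card_eq_UNIV_imp_eq_UNIV)
qed

lemma is_tile_iff_bij: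
  "is_tile E \<longleftrightarrow> (\<exists>A. bij_betw (\<lambda>(e, a). e + a) (E \<times> A) UNIV)"
proof -
  have "(\<forall>x. \<exists>!(e, a). e \<in> E \<and> a \<in> A \<and> x = e + a) \<longleftrightarrow> bij_betw (\<lambda>(e, a). e + a) (E \<times> A) UNIV" for A
    unfolding bij_betw_def inj_on_def Ex1_def image_def
    by (auto simp: set_eq_iff split_paired_all) metis+
  then show ?thesis
    by (simp add: is_tile_def)
qed

lemma complemented_imp_is_tile: "complemented E \<Longrightarrow> is_tile E"
  unfolding complemented_def is_tile_iff_bij using packing_tiles sumset_subgp by metis

lemma spectralI:
  fixes E B :: "(bit ^ 'd) set"
  assumes "E \<noteq> {}" "card B = card E" "\<And>b b'. b \<in> B \<Longrightarrow> b' \<in> B \<Longrightarrow> b \<noteq> b' \<Longrightarrow> fourier E (b + b') = 0"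
  shows "spectral E"
proof -
  have "(\<Sum>x\<in>E. exponential (b - b') x) = of_int (fourier E (b + b'))" for b b'
    by (simp add: exponential_eq_chi bit_vec_diff fourier_def)
  with assms show ?thesis
    unfolding spectral_iff[OF assms(1)] by (intro exI[of _ B]) auto
qed

lemma spectralD:
  fixes E :: "(bit ^ 'd) set"
  assumes "spectral E" "E \<noteq> {}"
  obtains B where "card B = card E" "\<And>b b'. b \<in> B \<Longrightarrow> b' \<in> B \<Longrightarrow> b \<noteq> b' \<Longrightarrow> fourier E (b + b') = 0"
proof -
  have "(\<Sum>x\<in>E. exponential (b - b') x) = of_int (fourier E (b + b'))" for b b'
    by (simp add: exponential_eq_chi bit_vec_diff fourier_def)
  with assms(1) show ?thesis
    unfolding spectral_iff[OF assms(2)] using that by auto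
qed

text \<open>The annihilator \<open>K\<close> of \<open>H\<close> is a spectrum. Double counting over
  \<open>H\<close> and all characters shows that \<open>card K * card H\<close> is N. For nonzero
  \<open>b\<close> in \<open>K\<close> the sum of \<open>chi b\<close> over the tiling is zero and
  factors as \<open>fourier E b\<close> times \<open>card H\<close>.\<close>

lemma complemented_imp_spectral:
  fixes E :: "(bit ^ 'd) set"
  assumes "complemented E" "E \<noteq> {}"
  shows "spectral E"
proof -
  obtain H where H: "subgp H" "H \<inter> sumset E \<subseteq> {0}" "CARD(bit ^ 'd) \<le> card E * card H"
    using assms(1) unfolding complemented_def by blast
  have bij: "bij_betw (\<lambda>(e, h). e + h) (E \<times> H) UNIV"
    using packing_tiles H sumset_subgp by metis
  then have card: "card E * card H = CARD(bit ^ 'd)"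
    using bij_betw_same_card by (fastforce simp: card_cartesian_product)
  define K where "K = {b. \<forall>h\<in>H. chi b h = 1}"
  have inner: "(\<Sum>h\<in>H. chi b h) = (if b \<in> K then int (card H) else 0)" for b
  proof (cases "b \<in> K")
    case False
    then obtain h where "h \<in> H" "chi b h = - 1"
      using chi_cases unfolding K_def by blast
    with H(1) False show ?thesis
      using sum_chi_subgroup[of H h b] by (simp add: subgp_def)
  qed (simp add: K_def)
  have "int CARD(bit ^ 'd) = (\<Sum>h\<in>H. if h = 0 then int CARD(bit ^ 'd) else 0)"
    using H(1) by (simp add: subgp_def)
  also have "\<dots> = (\<Sum>h\<in>H. \<Sum>b\<in>UNIV. chi b h)"
    by (rule sum.cong) (auto simp: sum_chi)
  also have "\<dots> = (\<Sum>b\<in>UNIV. \<Sum>h\<in>H. chi b h)"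
    by (rule sum.swap)
  also have "\<dots> = int (card K * card H)"
    by (simp add: inner sum.If_cases)
  finally have "card K * card H = card E * card H"
    using card of_nat_eq_iff by metis
  moreover have "card H \<noteq> 0"
    using H(1) by (auto simp: subgp_def)
  ultimately have cK: "card K = card E"
    by simp
  have "fourier E b = 0" if "b \<in> K" "b \<noteq> 0" for b
  proof -
    have "0 = (\<Sum>x\<in>UNIV. chi b x)"
      using sum_chi[of b] that(2) by (simp add: chi_commute[of b])
    also have "\<dots> = (\<Sum>(e, h)\<in>E \<times> H. chi b (e + h))"
      using sum.reindex_bij_betw[OF bij, of "chi b"] by (simp add: case_prod_unfold)
    also have "\<dots> = fourier E b * (\<Sum>h\<in>H. chi b h)"
      by (simp add: chi_add_right fourier_def sum_product sum.cartesian_product)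
    finally show ?thesis
      using inner[of b] that(1) \<open>card H \<noteq> 0\<close> by simp
  qed
  moreover have "b + b' \<in> K" if "b \<in> K" "b' \<in> K" for b b'
    using that by (simp add: K_def chi_add_left)
  ultimately show ?thesis
    using spectralI[OF assms(2) cK] by simp
qed

section \<open>Complements found greedily or as common kernels of characters\<close>

lemma subgp_extend:
  fixes H :: "(bit ^ 'd) set"
  assumes "subgp H" "u \<notin> H"
  shows "subgp (H \<union> (+) u ` H)" "card (H \<union> (+) u ` H) = 2 * card H"
proof -
  have sum: "x + y \<in> H" if "x \<in> H" "y \<in> H" for x y
    using assms(1) that by (simp add: subgp_def)
  have "x + (u + y) = u + (x + y)" "(u + x) + (u + y) = x + y" for x y
    by (simp_all add: bit_vec_ac)
  then show "subgp (H \<union> (+) u ` H)"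
    using assms(1) sum unfolding subgp_def by (auto simp: add.assoc)
  have "H \<inter> (+) u ` H = {}"
  proof (rule ccontr)
    assume "H \<inter> (+) u ` H \<noteq> {}"
    then obtain x where "x \<in> H" "u + x \<in> H"
      by blast
    then have "x + (u + x) \<in> H"
      by (rule sum)
    with assms(2) show False
      by (simp add: bit_vec_ac)
  qed
  then show "card (H \<union> (+) u ` H) = 2 * card H"
    by (simp add: card_Un_disjoint card_image)
qed

text \<open>Greedy doubling: any \<open>u\<close> in \<open>U\<close> outside \<open>D + H\<close>
  adds a coset that misses \<open>D\<close>, and \<open>0 \<in> D\<close> keeps \<open>u\<close> out
  of \<open>H\<close>. The factor 2 in the bound is there because the last doubling starts from a
  subgroup of order \<open>2 ^ (k - 1)\<close>.\<close>

lemma subgp_avoiding: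
  fixes U D :: "(bit ^ 'd) set"
  assumes "subgp U" "0 \<in> D" "card D * 2 ^ k < 2 * card U"
  obtains H where "subgp H" "H \<subseteq> U" "card H = 2 ^ k" "H \<inter> D \<subseteq> {0}"
  using assms(3)
proof (induction k arbitrary: thesis)
  case 0
  show ?case
    by (rule "0.prems"(1)[of "{0}"]) (use assms(1) in \<open>auto simp: subgp_def\<close>)
next
  case (Suc k)
  have small: "card D * 2 ^ k < card U"
    using Suc.prems(2) by simp
  then obtain H where H: "subgp H" "H \<subseteq> U" "card H = 2 ^ k" "H \<inter> D \<subseteq> {0}"
    using Suc.IH by (metis less_2_cases_iff less_le_trans le_add1 mult_2)
  define X where "X = (\<lambda>(x, y). x + y) ` (D \<times> H)"
  have "card X \<le> card D * 2 ^ k"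
    unfolding X_def using card_image_le[of "D \<times> H"] H(3) by (simp add: card_cartesian_product)
  then obtain u where u: "u \<in> U" "u \<notin> X"
    using small by (metis card_mono finite not_le order.trans subsetI)
  have "u \<notin> H"
    using u(2) assms(2) unfolding X_def by force
  show ?case
  proof (rule Suc.prems(1)[of "H \<union> (+) u ` H"])
    show "subgp (H \<union> (+) u ` H)" "card (H \<union> (+) u ` H) = 2 ^ Suc k"
      using subgp_extend[OF H(1) \<open>u \<notin> H\<close>] H(3) by simp_all
    show "H \<union> (+) u ` H \<subseteq> U"
      using H(2) u(1) assms(1) by (auto simp: subgp_def)
    have "u + h \<notin> D" if "h \<in> H" for h
    proof
      assume "u + h \<in> D"
      then have "(u + h) + h \<in> X"
        unfolding X_def using that by (intro image_eqI[of _ _ "(u + h, h)"]) auto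
      with u(2) show False
        by (simp add: bit_vec_ac)
    qed
    then show "(H \<union> (+) u ` H) \<inter> D \<subseteq> {0}"
      using H(4) by blast
  qed
qed

text \<open>Coincidences among the points are allowed, so sets of one or two points are covered by
  repeating entries.\<close>

lemma sumset_4: "sumset {p, q, r, w} = {0, p + q, p + r, p + w, q + r, q + w, r + w}"
proof (rule set_eqI)
  fix x
  have "x \<in> sumset {p, q, r, w} \<longleftrightarrow>
      (\<exists>a \<in> {p, q, r, w}. \<exists>b \<in> {p, q, r, w}. x = a + b)"
    unfolding sumset_def by blast
  then show "x \<in> sumset {p, q, r, w} \<longleftrightarrow> x \<in> {0, p + q, p + r, p + w, q + r, q + w, r + w}"
    by (simp add: add.commute) blast
qed

lemma card_7_le: "card {a, b, c, d, e, f, g} \<le> 7"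
  using card_length[of "[a, b, c, d, e, f, g]"] by simp

text \<open>A set of n points has at most 1 + n (n - 1) / 2 pair sums, which is below 2 n for n = 1,
  2, 4. The greedy choice with \<open>D = sumset E\<close> then reaches order N / n.\<close>

lemma complemented_card_le_4:
  fixes E :: "(bit ^ 'd) set"
  assumes "card E = 2 ^ m" "m \<le> 2" "m \<le> CARD('d)"
  shows "complemented E"
proof -
  obtain k where k: "CARD('d) = m + k"
    using assms(3) le_Suc_ex by blast
  have "card (sumset E) < 2 * card E \<and> 0 \<in> sumset E"
  proof -
    consider "m = 0" | "m = 1" | "m = 2"
      using assms(2) by linarith
    then show ?thesis
    proof cases
      case 1
      then obtain p where "E = {p}"
        using assms(1) by (auto simp: card_1_singleton_iff)
      then show ?thesis
        using sumset_4[of p p p p] by simp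
    next
      case 2
      then obtain p q where "E = {p, q}" "p \<noteq> q"
        using assms(1) by (auto simp: card_2_iff)
      then show ?thesis
        using sumset_4[of p p p q] by (simp add: add.commute card_insert_if)
    next
      case 3
      then obtain p q r w where E: "E = {p, q, r, w}"
        using assms(1) by (auto simp: card_Suc_eq numeral_eq_Suc)
      have "card (sumset E) \<le> 7"
        unfolding E sumset_4 by (rule card_7_le)
      then show ?thesis
        using assms(1) 3 E by (simp add: sumset_4)
    qed
  qed
  then have "card (sumset E) * 2 ^ k < 2 * card E * 2 ^ k" "0 \<in> sumset E"
    by simp_all
  then have "card (sumset E) * 2 ^ k < 2 * CARD(bit ^ 'd)"
    by (simp only: card_bit_vec assms(1) k power_add mult.assoc)
  moreover have "subgp (UNIV :: (bit ^ 'd) set)"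
    by (simp add: subgp_def)
  ultimately obtain H where "subgp H" "card H = 2 ^ k" "H \<inter> sumset E \<subseteq> {0}"
    using subgp_avoiding \<open>0 \<in> sumset E\<close> by metis
  then show ?thesis
    unfolding complemented_def
    by (intro exI[of _ H]) (simp only: card_bit_vec assms(1) k power_add, simp)
qed

text \<open>The count is one eighth of \<open>\<Sum>x\<in>S. (1 + chi a x) (1 + chi b x) (1 + chi c x)\<close>.\<close>

lemma card_common_kernel:
  fixes S :: "(bit ^ 'd) set"
  shows "8 * int (card {x \<in> S. chi a x = 1 \<and> chi b x = 1 \<and> chi c x = 1}) =
    int (card S) + fourier S a + fourier S b + fourier S c +
    fourier S (a + b) + fourier S (a + c) + fourier S (b + c) + fourier S (a + b + c)"
proof -
  have "8 * int (card {x \<in> S. chi a x = 1 \<and> chi b x = 1 \<and> chi c x = 1}) =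
      (\<Sum>x\<in>S. if chi a x = 1 \<and> chi b x = 1 \<and> chi c x = 1 then 8 else 0)"
    by (simp add: sum.If_cases Int_def)
  also have "\<dots> = (\<Sum>x\<in>S. (1 + chi a x) * (1 + chi b x) * (1 + chi c x))"
    by (rule sum.cong[OF refl]) (auto simp: chi_def)
  also have "\<dots> = int (card S) + fourier S a + fourier S b + fourier S c +
    fourier S (a + b) + fourier S (a + c) + fourier S (b + c) + fourier S (a + b + c)"
    by (simp add: fourier_def chi_add_left algebra_simps sum.distrib)
  finally show ?thesis .
qed

lemma fourier_translate: "fourier ((+) t ` S) b = chi b t * fourier S b"
  by (simp add: fourier_def sum.reindex chi_add_right sum_distrib_left)

text \<open>The common kernel \<open>H\<close> of the three characters is the complement. Since the
  transform of \<open>E\<close> vanishes at the seven listed sums, every translate of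
  \<open>E\<close> meets \<open>H\<close> in exactly one point. The translate by a point
  \<open>x\<close> of \<open>E\<close> contains 0, so \<open>x + y \<in> H\<close> only for
  \<open>y = x\<close>.\<close>

lemma complemented_of_three_characters:
  fixes E :: "(bit ^ 'd) set"
  assumes "card E = 8" "fourier E a = 0" "fourier E b = 0" "fourier E c = 0"
    "fourier E (a + b) = 0" "fourier E (a + c) = 0" "fourier E (b + c) = 0" "fourier E (a + b + c) = 0"
  shows "complemented E"
proof -
  define H where "H = {x. chi a x = 1 \<and> chi b x = 1 \<and> chi c x = 1}"
  \<comment> \<open>The transform of the whole space is never negative, so \<open>H\<close> has
    order at least N / 8 even if the characters are dependent.\<close>
  have nonneg: "fourier UNIV u \<ge> 0" for u :: "bit ^ 'd"
    using sum_chi[of u] by (simp add: fourier_def chi_commute[of u])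
  have "int CARD(bit ^ 'd) \<le> 8 * int (card H)"
    using card_common_kernel[of UNIV a b c] nonneg[of a] nonneg[of b] nonneg[of c]
      nonneg[of "a + b"] nonneg[of "a + c"] nonneg[of "b + c"] nonneg[of "a + b + c"]
    by (simp add: H_def)
  then have "CARD(bit ^ 'd) \<le> card E * card H"
    by (simp only: assms(1))
  moreover have "subgp H"
    by (simp add: subgp_def H_def chi_add_right)
  moreover have "x = y" if "x \<in> E" "y \<in> E" "x + y \<in> H" for x y
  proof -
    have "card ((+) x ` E) = 8"
      by (simp add: card_image assms(1))
    then have "card {z \<in> (+) x ` E. chi a z = 1 \<and> chi b z = 1 \<and> chi c z = 1} = 1"
      using card_common_kernel[of "(+) x ` E" a b c] by (simp add: fourier_translate assms)
    moreover have "{x + x, x + y} \<subseteq> {z \<in> (+) x ` E. chi a z = 1 \<and> chi b z = 1 \<and> chi c z = 1}"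
      using that by (auto simp: H_def)
    ultimately have "x + x = x + y"
      by (metis (no_types, lifting) card_1_singletonE insert_subset singletonD)
    then show ?thesis
      by simp
  qed
  ultimately show ?thesis
    using complementedI by blast
qed

subsection \<open>Spectral sets\<close>

text \<open>Parseval on \<open>B\<close> for the characters indexed by \<open>E\<close>: expanding
  the square leaves \<open>fourier B (x + y)\<close> off the diagonal, where it vanishes.\<close>

lemma sum_fourier_square:
  fixes E B :: "(bit ^ 'd) set"
  assumes "\<And>x y. x \<in> E \<Longrightarrow> y \<in> E \<Longrightarrow> x \<noteq> y \<Longrightarrow> fourier B (x + y) = 0"
  shows "(\<Sum>b\<in>B. (fourier E (b + t))\<^sup>2) = int (card E) * int (card B)"
proof -
  have "(\<Sum>b\<in>B. (fourier E (b + t))\<^sup>2)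
      = (\<Sum>b\<in>B. \<Sum>x\<in>E. \<Sum>y\<in>E. chi t (x + y) * chi (x + y) b)"
    by (simp add: fourier_def power2_eq_square sum_product chi_add_left chi_add_right
        chi_commute mult_ac)
  also have "\<dots> = (\<Sum>x\<in>E. \<Sum>y\<in>E. chi t (x + y) * fourier B (x + y))"
    by (subst sum.swap, rule sum.cong[OF refl], subst sum.swap)
      (simp add: sum_distrib_left fourier_def)
  also have "\<dots> = (\<Sum>x\<in>E. \<Sum>y\<in>E. if y = x then int (card B) else 0)"
    by (intro sum.cong refl) (auto simp: assms)
  also have "\<dots> = int (card E) * int (card B)"
    by simp
  finally show ?thesis .
qed

text \<open>Being a spectrum is symmetric for sets of equal size: in the sum of squares over
  \<open>E\<close> the term \<open>e = y\<close> already accounts for the whole total, so every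
  other term is zero.\<close>

lemma spectrum_dual:
  fixes E B :: "(bit ^ 'd) set"
  assumes "card B = card E"
    and "\<And>b b'. b \<in> B \<Longrightarrow> b' \<in> B \<Longrightarrow> b \<noteq> b' \<Longrightarrow> fourier E (b + b') = 0"
    and "x \<in> E" "y \<in> E" "x \<noteq> y"
  shows "fourier B (x + y) = 0"
proof -
  have "(\<Sum>e\<in>E. (fourier B (e + y))\<^sup>2) = (\<Sum>e\<in>{y}. (fourier B (e + y))\<^sup>2)"
    using sum_fourier_square[of B E y] assms(1,2) by (simp add: power2_eq_square)
  moreover have "(\<Sum>e\<in>E. (fourier B (e + y))\<^sup>2) =
      (\<Sum>e\<in>E - {y}. (fourier B (e + y))\<^sup>2) + (\<Sum>e\<in>{y}. (fourier B (e + y))\<^sup>2)"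
    using assms(4) by (intro sum.subset_diff) auto
  ultimately have "(\<Sum>e\<in>E - {y}. (fourier B (e + y))\<^sup>2) = 0"
    by linarith
  then show ?thesis
    using assms(3,5) by (subst (asm) sum_nonneg_eq_0_iff) auto
qed

lemma obtain_3_distinct:
  assumes "3 \<le> card S"
  obtains x y z where "x \<in> S" "y \<in> S" "z \<in> S" "x \<noteq> y" "x \<noteq> z" "y \<noteq> z"
proof -
  obtain T where "T \<subseteq> S" "card T = 3"
    using assms obtain_subset_with_card_n by metis
  then show thesis
    using that by (auto simp: card_3_iff)
qed

text \<open>The pair sums of three points of \<open>B\<close> form, with 0, a group of order 4. The
  transform of \<open>E\<close> vanishes on its nonzero elements, so its annihilator contains
  exactly a quarter of \<open>E\<close>.\<close>

lemma spectrum_card_dvd_4: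
  fixes E B :: "(bit ^ 'd) set"
  assumes "\<And>b b'. b \<in> B \<Longrightarrow> b' \<in> B \<Longrightarrow> b \<noteq> b' \<Longrightarrow> fourier E (b + b') = 0" "3 \<le> card B"
  shows "4 dvd card E"
proof -
  obtain x y z where b: "x \<in> B" "y \<in> B" "z \<in> B" "x \<noteq> y" "x \<noteq> z" "y \<noteq> z"
    using obtain_3_distinct[OF assms(2)] by blast
  have "(x + y) + (x + z) = y + z"
    by (simp add: bit_vec_ac)
  \<comment> \<open>The third character is 0, so every term of the count occurs twice.\<close>
  then have "8 * int (card {e \<in> E. chi (x + y) e = 1 \<and> chi (x + z) e = 1 \<and> chi 0 e = 1}) = 2 * int (card E)"
    using card_common_kernel[of E "x + y" "x + z" 0] b assms(1) by simp
  then show ?thesis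
    by presburger
qed

text \<open>Four of five points with zero sum leave, relative to the fifth, a subgroup of order 8 of
  sums of pairs.\<close>

lemma spectrum_card_dvd_8:
  fixes E B :: "(bit ^ 'd) set"
  assumes "\<And>b b'. b \<in> B \<Longrightarrow> b' \<in> B \<Longrightarrow> b \<noteq> b' \<Longrightarrow> fourier E (b + b') = 0"
    and "x \<in> B" "y \<in> B" "z \<in> B" "w \<in> B" "v \<in> B" "distinct [x, y, z, w, v]" "x + y = z + w"
  shows "8 dvd card E"
proof -
  have w: "w = x + y + z"
    using assms(8) by (simp add: bit_vec_ac)
  have "(x + v) + (y + v) = x + y" "(x + v) + (z + v) = x + z" "(y + v) + (z + v) = y + z"
    by (simp_all add: bit_vec_ac)
  moreover have "(x + v) + (y + v) + (z + v) = w + v"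
    unfolding w by (simp add: bit_vec_ac)
  ultimately have "8 * int (card {e \<in> E. chi (x + v) e = 1 \<and> chi (y + v) e = 1 \<and> chi (z + v) e = 1}) = int (card E)"
    using card_common_kernel[of E "x + v" "y + v" "z + v"] assms by simp
  then show ?thesis
    by presburger
qed

text \<open>Pigeonhole: sums of two distinct points are nonzero, so they take at most N - 1 values.
  Two different pairs with equal sum cannot share a point.\<close>

lemma coincident_pair_sums:
  fixes B :: "(bit ^ 'd) set"
  assumes "CARD(bit ^ 'd) \<le> card B choose 2"
  obtains x y z w where "x \<in> B" "y \<in> B" "z \<in> B" "w \<in> B" "distinct [x, y, z, w]" "x + y = z + w"
proof -
  define P where "P = {S. S \<subseteq> B \<and> card S = 2}"
  have sum_in: "\<Sum>S \<in> UNIV - {0}" if "S \<in> P" for S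
    using that by (auto simp: P_def card_2_iff)
  have "card P = card B choose 2"
    unfolding P_def by (rule n_subsets) simp
  moreover have "card (UNIV - {0 :: bit ^ 'd}) < CARD(bit ^ 'd)"
    by (rule psubset_card_mono) auto
  ultimately have "card (UNIV - {0 :: bit ^ 'd}) < card P"
    using assms by linarith
  moreover have "(\<lambda>S. \<Sum>S) ` P \<subseteq> UNIV - {0}"
    by (intro image_subsetI sum_in)
  ultimately have "\<not> inj_on (\<lambda>S. \<Sum>S) P"
    by (metis card_inj_on_le finite leD)
  then obtain S T where ST: "S \<in> P" "T \<in> P" "S \<noteq> T" "\<Sum>S = \<Sum>T"
    by (auto simp: inj_on_def)
  then obtain x y z w where S: "S = {x, y}" "x \<noteq> y" and T: "T = {z, w}" "z \<noteq> w"
    by (auto simp: P_def card_2_iff)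
  have eq: "x + y = z + w"
    using ST(4) S T by simp
  have "x \<noteq> z" "x \<noteq> w" "y \<noteq> z" "y \<noteq> w"
    using eq ST(3) S T by (auto simp: add.commute insert_commute)
  then show thesis
    using that[of x y z w] ST(1,2) S T eq by (simp add: P_def)
qed

text \<open>Fix \<open>x\<close>, \<open>y\<close>, \<open>z\<close> in \<open>B\<close>. For a
  further \<open>u\<close> in \<open>B\<close>, six of the seven nonzero combinations of
  \<open>x + y\<close>, \<open>x + z\<close>, \<open>x + u\<close> are pair sums of
  \<open>B\<close>; only \<open>u + ?t\<close> escapes. Counting the common kernel makes the
  transform there divisible by 8, while the squares over \<open>B\<close> add up to 64, so it is
  nonzero for at most one of two choices of \<open>u\<close>.\<close>

lemma complemented_of_spectrum_8:
  fixes E B :: "(bit ^ 'd) set"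
  assumes "card E = 8" "card B = 8"
    and "\<And>b b'. b \<in> B \<Longrightarrow> b' \<in> B \<Longrightarrow> b \<noteq> b' \<Longrightarrow> fourier E (b + b') = 0"
  shows "complemented E"
proof -
  obtain x y z where b: "x \<in> B" "y \<in> B" "z \<in> B" "x \<noteq> y" "x \<noteq> z" "y \<noteq> z"
    using obtain_3_distinct[of B] assms(2) by (metis eval_nat_numeral(3) nat_le_linear not_less_eq_eq numeral_le_iff semiring_norm(69,70,71))
  have "card (B - {x, y, z}) = 5"
    using b assms(2) by (simp add: card_Diff_subset)
  then obtain v w where vw: "v \<in> B - {x, y, z}" "w \<in> B - {x, y, z}" "v \<noteq> w"
    by (metis card_eq_0_iff card_le_Suc0_iff_eq card.infinite finite numeral_le_one_iff One_nat_def semiring_norm(70))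
  let ?t = "x + y + z"
  have id: "(x + y) + (x + z) = y + z" "(x + y) + (x + u) = y + u" "(x + z) + (x + u) = z + u"
    "y + z + (x + u) = u + ?t" for u
    by (simp_all add: bit_vec_ac)
  have dvd: "8 dvd fourier E (u + ?t)" if "u \<in> B - {x, y, z}" for u
  proof -
    have "fourier E (x + u) = 0" "fourier E (y + u) = 0" "fourier E (z + u) = 0"
      using that b by (auto intro!: assms(3))
    then have "8 * int (card {e \<in> E. chi (x + y) e = 1 \<and> chi (x + z) e = 1 \<and> chi (x + u) e = 1}) = 8 + fourier E (u + ?t)"
      using card_common_kernel[of E "x + y" "x + z" "x + u"] b assms unfolding id by simp
    then show ?thesis
      by presburger
  qed
  have dual: "fourier B (p + q) = 0" if "p \<in> E" "q \<in> E" "p \<noteq> q" for p q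
    using spectrum_dual[of B E p q] assms that by simp
  have "(\<Sum>b\<in>{v, w}. (fourier E (b + ?t))\<^sup>2) \<le> (\<Sum>b\<in>B. (fourier E (b + ?t))\<^sup>2)"
    using vw by (intro sum_mono2) auto
  also have "\<dots> = 64"
    using sum_fourier_square[of E B ?t] dual assms(1,2) by simp
  finally have le: "(fourier E (v + ?t))\<^sup>2 + (fourier E (w + ?t))\<^sup>2 \<le> 64"
    using vw(3) by simp
  have "fourier E (v + ?t) = 0 \<or> fourier E (w + ?t) = 0"
  proof (rule ccontr)
    have big: "64 \<le> f\<^sup>2" if "8 dvd f" "f \<noteq> 0" for f :: int
    proof -
      have "\<bar>8\<bar> \<le> \<bar>f\<bar>"
        using that by (metis dvd_imp_le_int)
      then have "8\<^sup>2 \<le> f\<^sup>2"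
        by (simp only: abs_le_square_iff)
      then show ?thesis
        by simp
    qed
    assume "\<not> ?thesis"
    then have "64 \<le> (fourier E (v + ?t))\<^sup>2" "64 \<le> (fourier E (w + ?t))\<^sup>2"
      using big dvd vw by blast+
    with le show False
      by linarith
  qed
  then obtain u where "u \<in> B - {x, y, z}" "fourier E (u + ?t) = 0"
    using vw by blast
  then show ?thesis
    using b assms by (intro complemented_of_three_characters[of E "x + y" "x + z" "x + u"]) (simp_all only: id, auto)
qed

lemma spectral_imp_complemented:
  fixes E :: "(bit ^ 'd) set"
  assumes "CARD('d) \<in> {5, 6}" "E \<noteq> {}" "spectral E"
  shows "complemented E"
proof -
  let ?N = "CARD(bit ^ 'd)"
  have N: "?N = 32 \<or> ?N = 64"
    using assms(1) by (auto simp: card_bit)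
  obtain B where B: "card B = card E" "\<And>b b'. b \<in> B \<Longrightarrow> b' \<in> B \<Longrightarrow> b \<noteq> b' \<Longrightarrow> fourier E (b + b') = 0"
    using spectralD assms(2,3) by blast
  have dual: "fourier B (x + y) = 0" if "x \<in> E" "y \<in> E" "x \<noteq> y" for x y
    using spectrum_dual[OF B] that by blast
  have E0: "card E \<noteq> 0"
    using assms(2) by simp
  \<comment> \<open>By duality the transform of \<open>B\<close> vanishes on the nonzero part of
    \<open>E + E\<close>, so a subgroup within its support is a complement once it is large
    enough.\<close>
  have comp: "complemented E" if H: "subgp H" "\<And>h. h \<in> H \<Longrightarrow> h \<noteq> 0 \<Longrightarrow> fourier B h \<noteq> 0" "?N \<le> card E * card H" for H
    using H(1) _ H(3)
  proof (rule complementedI)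
    show "x = y" if "x \<in> E" "y \<in> E" "x + y \<in> H" for x y
      using H(2)[OF that(3)] dual[OF that(1,2)] by auto
  qed
  show ?thesis
  proof (cases "\<exists>h. h \<noteq> 0 \<and> fourier B h \<noteq> 0")
    case False
    have "B \<noteq> {}"
      using B(1) E0 by auto
    then have "B = UNIV"
      using False fourier_vanishing_imp_UNIV by metis
    then show ?thesis
      using comp[of "{0}"] B(1) by (simp add: subgp_def)
  next
    case True
    then obtain h where h: "h \<noteq> 0" "fourier B h \<noteq> 0"
      by blast
    show ?thesis
    proof (cases "\<exists>u. u \<noteq> 0 \<and> u \<noteq> h \<and> fourier B u \<noteq> 0 \<and> fourier B (u + h) \<noteq> 0")
      case False
      \<comment> \<open>Without such a \<open>u\<close>, only two terms of the convolution identity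
        at \<open>h\<close> survive, which forces \<open>2 * card E = ?N\<close>.\<close>
      have "(\<Sum>u\<in>UNIV. fourier B u * fourier B (u + h)) = (\<Sum>u\<in>{0, h}. fourier B u * fourier B (u + h))"
        using False by (intro sum.mono_neutral_right) auto
      then have "2 * int (card E) * fourier B h = int ?N * fourier B h"
        using h(1) fourier_convolution[of B h] B(1) by (simp only: sum.insert finite.intros empty_iff insert_iff) simp
      then have "2 * int (card E) = int ?N"
        by (rule mult_right_cancel[OF h(2), THEN iffD1])
      then have "2 * card E = ?N"
        by linarith
      then show ?thesis
        using h comp[of "{0, h}"] by (simp add: subgp_def)
    next
      case True
      then obtain u where u: "u \<noteq> 0" "u \<noteq> h" "fourier B u \<noteq> 0" "fourier B (u + h) \<noteq> 0"
        by blast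
      \<comment> \<open>This subgroup of order 4 lies in the support of the transform of
        \<open>B\<close>, so it packs with \<open>E\<close>.\<close>
      define H where "H = {0, h} \<union> (+) u ` {0, h}"
      have "subgp {0, h}" "card {0, h} = 2" "u \<notin> {0, h}"
        using h(1) u(1,2) by (auto simp: subgp_def)
      then have H: "subgp H" "\<And>h. h \<in> H \<Longrightarrow> h \<noteq> 0 \<Longrightarrow> fourier B h \<noteq> 0" "card H = 4"
        unfolding H_def using subgp_extend[of "{0, h}" u] h(2) u(3,4) by auto
      have pack: "sumset H \<inter> sumset E \<subseteq> {0}"
        unfolding sumset_subgp[OF H(1)]
      proof
        fix z assume "z \<in> H \<inter> sumset E"
        then obtain x y where "z \<in> H" "x \<in> E" "y \<in> E" "z = x + y"
          unfolding sumset_def by blast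
        then show "z \<in> {0}"
          using H(2)[of z] dual[of x y] by auto
      qed
      then have le: "4 * card E \<le> ?N"
        using card_packing_le[OF pack] H(3) by simp
      have 4: "3 \<le> card E \<longrightarrow> 4 dvd card E"
        using spectrum_card_dvd_4[of B E] B by simp
      have "card E \<noteq> 12"
      proof
        assume 12: "card E = 12"
        \<comment> \<open>Twelve points have 66 pairs, more than N. A coincidence of sums, together
          with a fifth point of \<open>B\<close>, would make 12 divisible by 8.\<close>
        have "?N \<le> card B choose 2"
          using N B(1) 12 by (auto simp: choose_two)
        then obtain x y z w where *: "x \<in> B" "y \<in> B" "z \<in> B" "w \<in> B" "distinct [x, y, z, w]" "x + y = z + w"
          using coincident_pair_sums by blast
        have "card {x, y, z, w} = 4"
          using *(5) distinct_card by fastforce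
        then have "\<not> B \<subseteq> {x, y, z, w}"
          using card_mono[of "{x, y, z, w}" B] B(1) 12 by auto
        then obtain v where "v \<in> B" "v \<notin> {x, y, z, w}"
          by blast
        then have "8 dvd card E"
          using * B(2) by (intro spectrum_card_dvd_8[of B E x y z w v]) auto
        with 12 show False
          by simp
      qed
      moreover have "card E \<le> 16"
        using le N by auto
      ultimately have "card E = 1 \<or> card E = 2 \<or> card E = 4 \<or> card E = 8 \<or> card E = 16"
        using 4 E0 by presburger
      then consider "card E = 16" | "card E = 8" | m where "m \<le> 2" "card E = 2 ^ m"
        by (auto intro: that(3)[of 0] that(3)[of 1] that(3)[of 2])
      then show ?thesis
      proof cases
        case 1
        \<comment> \<open>Order 16 leaves only N = 64, where \<open>H\<close> of order 4 is large
          enough.\<close>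
        then show ?thesis
          using comp[OF H(1,2)] H(3) le N by auto
      next
        case 2
        then show ?thesis
          using B complemented_of_spectrum_8[of E B] by simp
      next
        case 3
        then show ?thesis
          using complemented_card_le_4[of E m] assms(1) by auto
      qed
    qed
  qed
qed

subsection \<open>Tiles\<close>

lemma tile_packing:
  fixes E A :: "(bit ^ 'd) set"
  assumes "bij_betw (\<lambda>(e, a). e + a) (E \<times> A) UNIV"
  shows "sumset A \<inter> sumset E \<subseteq> {0}"
proof
  fix z assume "z \<in> sumset A \<inter> sumset E"
  then obtain x y a b where z: "z = x + y" "z = a + b" and *: "x \<in> E" "y \<in> E" "a \<in> A" "b \<in> A"
    unfolding sumset_def by blast
  have "x = (x + y) + y"
    by (simp add: add.assoc)
  then have "x = (a + b) + y"
    using z by simp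
  then have "x + a = y + b"
    by (simp add: bit_vec_ac)
  then have "x = y"
    using assms * by (auto simp: bij_betw_def inj_on_def)
  then show "z \<in> {0}"
    using z by simp
qed

text \<open>The sum of \<open>chi u\<close> over the whole group is zero and, read along the tiling,
  factors.\<close>

lemma tile_fourier:
  fixes E A :: "(bit ^ 'd) set"
  assumes "bij_betw (\<lambda>(e, a). e + a) (E \<times> A) UNIV" "u \<noteq> 0"
  shows "fourier E u * fourier A u = 0"
proof -
  have "0 = (\<Sum>x\<in>UNIV. chi u x)"
    using sum_chi[of u] assms(2) by (simp add: chi_commute[of u])
  also have "\<dots> = (\<Sum>(e, a)\<in>E \<times> A. chi u (e + a))"
    using sum.reindex_bij_betw[OF assms(1), of "chi u"] by (simp add: case_prod_unfold)
  also have "\<dots> = fourier E u * fourier A u"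
    by (simp add: chi_add_right fourier_def sum_product sum.cartesian_product)
  finally show ?thesis
    by simp
qed

text \<open>Since \<open>A + A\<close> and \<open>E + E\<close> share no nonzero element,
  complements may be sought inside \<open>A + A\<close>.\<close>

lemma complemented_of_packing:
  fixes E A H :: "(bit ^ 'd) set"
  assumes "sumset A \<inter> sumset E \<subseteq> {0}" "subgp H" "H \<subseteq> sumset A" "CARD(bit ^ 'd) \<le> card E * card H"
  shows "complemented E"
  using assms unfolding complemented_def by blast

lemma subgp_of_three_points:
  fixes p q r :: "bit ^ 'd"
  assumes "p \<noteq> q" "p \<noteq> r" "q \<noteq> r"
  shows "subgp {0, p + q, p + r, q + r}" "card {0, p + q, p + r, q + r} = 4"
  using assms by (auto simp: subgp_def bit_vec_ac card_insert_if)

lemma subset_sumset_of_three_points: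
  "p \<in> A \<Longrightarrow> q \<in> A \<Longrightarrow> r \<in> A \<Longrightarrow> {0, p + q, p + r, q + r} \<subseteq> sumset A"
  unfolding sumset_def by (auto intro: exI[of _ p])

text \<open>Equality in the triangle inequality forces all summands to agree; for nonzero
  \<open>b\<close> this places \<open>S\<close> in an affine hyperplane.\<close>

lemma constant_chi_of_abs_fourier:
  assumes "\<bar>fourier S b\<bar> = int (card S)"
  shows "\<exists>c. \<forall>x\<in>S. chi b x = c"
proof -
  define c :: int where "c = (if fourier S b < 0 then - 1 else 1)"
  have "c * fourier S b = int (card S)"
    using assms by (cases "fourier S b < 0") (simp_all add: c_def)
  then have "(\<Sum>x\<in>S. 1 - c * chi b x) = 0"
    by (simp add: sum_subtractf fourier_def sum_distrib_left)
  moreover have nonneg: "0 \<le> 1 - c * chi b x" for x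
    by (simp add: c_def chi_def)
  ultimately have "\<forall>x\<in>S. 1 - c * chi b x = 0"
    using sum_nonneg_eq_0_iff[of S "\<lambda>x. 1 - c * chi b x"] by simp
  then have "\<forall>x\<in>S. chi b x = c"
    by (auto simp: c_def)
  then show ?thesis
    by blast
qed

section \<open>Tilings of a group of order 64 by two sets of order 8\<close>

text \<open>Three points of \<open>A\<close> lie on the same side of \<open>w\<close>, and their
  pair sums give a subgroup of order 4 in the kernel of \<open>chi w\<close> that meets
  \<open>E + E\<close> only in 0. Adjoining \<open>t\<close> with \<open>chi w t = - 1\<close> adds
  a coset that misses \<open>E + E\<close>, on which \<open>chi w\<close> is 1.\<close>

lemma complemented_tile_in_hyperplane:
  fixes E A :: "(bit ^ 'd) set"
  assumes "CARD(bit ^ 'd) = 64" "card E = 8" "card A = 8" "sumset A \<inter> sumset E \<subseteq> {0}"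
    and "w \<noteq> 0" "\<forall>x\<in>E. chi w x = c"
  shows "complemented E"
proof -
  have "A = {a \<in> A. chi w a = 1} \<union> {a \<in> A. chi w a = - 1}"
    using chi_cases by auto
  then have "8 \<le> card {a \<in> A. chi w a = 1} + card {a \<in> A. chi w a = - 1}"
    using card_Un_le[of "{a \<in> A. chi w a = 1}" "{a \<in> A. chi w a = - 1}"] assms(3) by simp
  then have "3 \<le> card {a \<in> A. chi w a = 1} \<or> 3 \<le> card {a \<in> A. chi w a = - 1}"
    by linarith
  then obtain k where "3 \<le> card {a \<in> A. chi w a = k}"
    by blast
  then obtain p q r where *: "p \<in> {a \<in> A. chi w a = k}" "q \<in> {a \<in> A. chi w a = k}"
      "r \<in> {a \<in> A. chi w a = k}" "p \<noteq> q" "p \<noteq> r" "q \<noteq> r"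
    using obtain_3_distinct by blast
  define H where "H = {0, p + q, p + r, q + r}"
  have H: "subgp H" "card H = 4" "H \<subseteq> sumset A"
    unfolding H_def using subgp_of_three_points[of p q r] subset_sumset_of_three_points[of p A q r] * by simp_all
  have Hw: "chi w x = 1" if "x \<in> H" for x
    using that * unfolding H_def by (auto simp: chi_add_right)
  obtain t where t: "chi w t = - 1"
    using separating_chi assms(5) chi_commute by metis
  then have "t \<notin> H"
    using Hw by force
  have "(H \<union> (+) t ` H) \<inter> sumset E \<subseteq> H \<inter> sumset E"
    using assms(6) t Hw by (auto simp: sumset_def chi_add_right) (metis chi_add_right chi_square mult_minus1 one_neq_neg_one)
  also have "\<dots> \<subseteq> {0}"
    using H(3) assms(4) by blast
  finally show ?thesis
    unfolding complemented_def
    by (intro exI[of _ "H \<union> (+) t ` H"]) (use subgp_extend[OF H(1) \<open>t \<notin> H\<close>] H(2) assms in simp)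
qed

text \<open>With \<open>a\<close>, \<open>b\<close>, \<open>c\<close> in different cosets of
  \<open>{0, s}\<close>, the subgroup spanned by \<open>s\<close>, \<open>a + b\<close>,
  \<open>a + c\<close> has order 8. It lies in \<open>A + A\<close>, because a summand from
  \<open>A\<close> absorbs the period \<open>s\<close>.\<close>

lemma complemented_of_periodic_partner:
  fixes E A :: "(bit ^ 'd) set"
  assumes "CARD(bit ^ 'd) = 64" "card E = 8" "card A = 8" "sumset A \<inter> sumset E \<subseteq> {0}"
    and "s \<noteq> 0" "\<And>a. a \<in> A \<Longrightarrow> a + s \<in> A"
  shows "complemented E"
proof -
  have pick: "\<exists>a\<in>A. a \<notin> {x, y, z, w}" for x y z w
  proof (rule ccontr)
    assume "\<not> ?thesis"
    then have "card A \<le> card {x, y, z, w}"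
      by (intro card_mono) auto
    also have "\<dots> \<le> 4"
      using card_length[of "[x, y, z, w]"] by simp
    finally show False
      using assms(3) by simp
  qed
  obtain a b c where a: "a \<in> A" and b: "b \<in> A" "b \<notin> {a, a + s, a, a}"
    and c: "c \<in> A" "c \<notin> {a, a + s, b, b + s}"
    using pick by metis
  define K where "K = {0, s}"
  have K: "subgp K" "card K = 2"
    using assms(5) by (auto simp: K_def subgp_def)
  have ab: "a + b \<notin> K"
    using b(2) unfolding K_def by (auto simp: bit_vec_ac)
  define L where "L = K \<union> (+) (a + b) ` K"
  have L: "subgp L" "card L = 4"
    using subgp_extend[OF K(1) ab] K(2) by (simp_all add: L_def)
  have ac: "a + c \<notin> L"
  proof
    assume "a + c \<in> L"
    then have "a + c \<in> {0, s, a + b, a + b + s}"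
      unfolding L_def K_def by auto
    then have "a + (a + c) \<in> (+) a ` {0, s, a + b, a + b + s}"
      by (rule imageI)
    with c(2) show False
      by (simp add: add.assoc)
  qed
  have "L \<union> (+) (a + c) ` L = {0, a + (a + s), a + b, a + (b + s), a + c, a + (c + s), b + c, b + (c + s)}"
    unfolding L_def K_def by (simp add: bit_vec_ac insert_commute)
  also have "\<dots> \<subseteq> sumset A"
  proof -
    have "x + y \<in> sumset A" if "x \<in> A" "y \<in> A" for x y
      using that unfolding sumset_def by blast
    note mem = this[OF a] this[OF b(1)]
    show ?thesis
      using mem(1)[OF a] mem(1)[OF b(1)] mem(1)[OF c(1)] mem(2)[OF c(1)]
        mem(1)[OF assms(6)[OF a]] mem(1)[OF assms(6)[OF b(1)]] mem(1)[OF assms(6)[OF c(1)]]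
        mem(2)[OF assms(6)[OF c(1)]] by simp
  qed
  finally show ?thesis
    using complemented_of_packing[OF assms(4), of "L \<union> (+) (a + c) ` L"]
      subgp_extend[OF L(1) ac] L(2) assms(1,2) by simp
qed

text \<open>The point \<open>a + (q + r + w)\<close> is covered by some \<open>e + a'\<close>, and
  \<open>chi h\<close> puts \<open>e\<close> in the same half as \<open>p\<close>. Taking
  \<open>e\<close> to be \<open>q\<close>, \<open>r\<close> or \<open>w\<close> would make
  \<open>a + a'\<close> a nonzero element of \<open>E + E\<close>, so \<open>e = p\<close> and
  \<open>a'\<close> is the shifted point.\<close>

lemma partner_period:
  fixes E A :: "(bit ^ 'd) set"
  assumes "bij_betw (\<lambda>(e, a). e + a) (E \<times> A) UNIV" "\<forall>x\<in>A. chi h x = c"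
    and "{e \<in> E. chi h e = k} = {p, q, r, w}" "distinct [p, q, r, w]" "a \<in> A"
  shows "a + (p + q + r + w) \<in> A"
proof -
  have in_E: "p \<in> E" "q \<in> E" "r \<in> E" "w \<in> E" and k: "chi h p = k" "chi h q = k" "chi h r = k" "chi h w = k"
    using assms(3) by auto
  have "a + (q + r + w) \<in> (\<lambda>(e, a). e + a) ` (E \<times> A)"
    using assms(1) by (simp add: bij_betw_def)
  then obtain e a' where e: "e \<in> E" "a' \<in> A" "a + (q + r + w) = e + a'"
    by auto
  have "chi h (a + (q + r + w)) = chi h (e + a')"
    using e(3) by simp
  then have "chi h a * (k * (k * k)) = chi h e * chi h a'"
    by (simp add: chi_add_right k mult.assoc)
  moreover have "chi h a = chi h a'"
    using assms(2,5) e(2) by simp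
  ultimately have "chi h e = k"
    using chi_cases[of h p] chi_cases[of h a'] k(1) by auto
  then have cases: "e \<in> {p, q, r, w}"
    using assms(3) e(1) by blast
  have clash: False if "a + a' = x + y" "x \<in> E" "y \<in> E" "x \<noteq> y" for x y
  proof -
    have "a + a' \<in> sumset A" "x + y \<in> sumset E"
      using that assms(5) e(2) unfolding sumset_def by blast+
    then have "x + y \<in> sumset A \<inter> sumset E"
      using that(1) by simp
    then show False
      using tile_packing[OF assms(1)] that(4) by auto
  qed
  have a': "a' = e + (a + (q + r + w))"
    using e(3) by simp
  have "a + a' = r + w" if "e = q"
    unfolding a' that by (simp add: bit_vec_ac)
  moreover have "a + a' = q + w" if "e = r"
    unfolding a' that by (simp add: bit_vec_ac)
  moreover have "a + a' = q + r" if "e = w"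
    unfolding a' that by (simp add: bit_vec_ac)
  ultimately have "e = p"
    using cases clash in_E assms(4) by (metis distinct_length_2_or_more insertE singletonD)
  then have "a + (p + q + r + w) = a'"
    unfolding a' by (simp add: bit_vec_ac)
  then show ?thesis
    using e(2) by simp
qed

lemma obtain_4_distinct:
  assumes "card S = 4"
  obtains p q r w where "S = {p, q, r, w}" "distinct [p, q, r, w]"
proof -
  obtain xs where "set xs = S" "length xs = 4" "distinct xs"
    using assms finite_distinct_list by (metis card.infinite distinct_card zero_neq_numeral)
  then show thesis
    using that by (auto simp: numeral_eq_Suc length_Suc_conv)
qed

lemma card_balanced_half:
  assumes "card E = 8" "fourier E h = 0"
  shows "card {e \<in> E. chi h e = 1} = 4" "card {e \<in> E. chi h e = - 1} = 4"
proof -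
  let ?P = "{e \<in> E. chi h e = 1}" and ?Q = "{e \<in> E. chi h e = - 1}"
  have fin: "finite E"
    using assms(1) card.infinite by fastforce
  have E: "E = ?P \<union> ?Q" "?P \<inter> ?Q = {}"
    using chi_cases by auto
  have "card E = card ?P + card ?Q"
    by (subst E(1), rule card_Un_disjoint) (use E(2) fin in auto)
  moreover have "fourier E h = (\<Sum>e\<in>?P. chi h e) + (\<Sum>e\<in>?Q. chi h e)"
    unfolding fourier_def by (subst E(1), rule sum.union_disjoint) (use E(2) fin in auto)
  ultimately show "card ?P = 4" "card ?Q = 4"
    using assms by simp_all
qed

text \<open>The character \<open>h\<close> balances \<open>E\<close>. A half of \<open>E\<close>
  with nonzero sum yields a period of \<open>A\<close>. Otherwise both halves are affine planes, so
  sums within a half take at most seven values, and a complement is found greedily inside the kernel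
  of \<open>chi h\<close>, which contains no sum across the halves.\<close>

lemma complemented_tile_partner_in_hyperplane:
  fixes E A :: "(bit ^ 'd) set"
  assumes N: "CARD(bit ^ 'd) = 64" "card E = 8" "card A = 8"
    and bij: "bij_betw (\<lambda>(e, a). e + a) (E \<times> A) UNIV"
    and h: "h \<noteq> 0" "\<forall>x\<in>A. chi h x = c"
  shows "complemented E"
proof -
  have "fourier A h = 8 * c"
    using h(2) N(3) by (simp add: fourier_def)
  moreover have "c \<noteq> 0"
    using h(2) N(3) chi_cases by (metis card.empty equals0I one_neq_zero neg_equal_0_iff_equal zero_neq_numeral)
  ultimately have "fourier E h = 0"
    using tile_fourier[OF bij h(1)] by simp
  note half = card_balanced_half[OF N(2) this]
  obtain p0 p1 p2 p3 where P: "{e \<in> E. chi h e = 1} = {p0, p1, p2, p3}" "distinct [p0, p1, p2, p3]"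
    using obtain_4_distinct[OF half(1)] by blast
  obtain q0 q1 q2 q3 where Q: "{e \<in> E. chi h e = - 1} = {q0, q1, q2, q3}" "distinct [q0, q1, q2, q3]"
    using obtain_4_distinct[OF half(2)] by blast
  show ?thesis
  proof (cases "p0 + p1 + p2 + p3 = 0 \<and> q0 + q1 + q2 + q3 = 0")
    case False
    then obtain s where "s \<noteq> 0" "\<And>a. a \<in> A \<Longrightarrow> a + s \<in> A"
      using partner_period[OF bij h(2) P] partner_period[OF bij h(2) Q] by blast
    then show ?thesis
      using complemented_of_periodic_partner[OF N tile_packing[OF bij]] by blast
  next
    case True
    then have flat: "p3 = p0 + p1 + p2" "q3 = q0 + q1 + q2"
      by (metis bit_vec_add_eq_0_iff)+
    let ?D = "sumset {p0, p1, p2, p3} \<union> sumset {q0, q1, q2, q3}"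
    have "?D = {0, p0 + p1, p0 + p2, p1 + p2, q0 + q1, q0 + q2, q1 + q2}"
      unfolding sumset_4 flat by (auto simp: bit_vec_ac)
    then have D: "card ?D \<le> 7" "0 \<in> ?D"
      using card_7_le by simp_all
    define U where "U = {x. chi h x = 1}"
    have "fourier UNIV h = 0"
      using sum_chi[of h] h(1) by (simp add: fourier_def chi_commute[of h])
    then have "8 * int (card U) = 4 * int CARD(bit ^ 'd)"
      using card_common_kernel[of UNIV h 0 0] by (simp add: U_def)
    then have U: "card U = 32" "subgp U"
      unfolding N(1) by (simp_all add: U_def subgp_def chi_add_right)
    \<comment> \<open>The greedy bound reads 7 * 8 < 2 * 32.\<close>
    obtain H where H: "subgp H" "H \<subseteq> U" "card H = 2 ^ 3" "H \<inter> ?D \<subseteq> {0}"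
      using subgp_avoiding[OF U(2) D(2), of 3] D(1) U(1) by auto
    have "x = y" if "x \<in> E" "y \<in> E" "x + y \<in> H" for x y
    proof -
      have "chi h x * chi h y = 1"
        using H(2) that(3) unfolding U_def chi_add_right[symmetric] by blast
      then have "chi h x = chi h y"
        using chi_cases[of h x] chi_cases[of h y] by auto
      then have "x \<in> {p0, p1, p2, p3} \<and> y \<in> {p0, p1, p2, p3} \<or> x \<in> {q0, q1, q2, q3} \<and> y \<in> {q0, q1, q2, q3}"
        using that(1,2) chi_cases[of h x] unfolding P(1)[symmetric] Q(1)[symmetric] by auto
      then have "x + y \<in> ?D"
        unfolding sumset_def by blast
      then show ?thesis
        using H(4) that(3) by auto
    qed
    then show ?thesis
      using complementedI[OF H(1)] H(3) N by simp
  qed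
qed

text \<open>Numbers the three ways of splitting four points evenly.\<close>

definition split_type :: "int \<Rightarrow> int \<Rightarrow> int \<Rightarrow> int"
  where "split_type a0 a1 a2 = (if a1 = a0 then 0 else if a2 = a0 then 1 else 2)"

lemma split_type_range: "0 \<le> split_type a b c" "split_type a b c \<le> 2"
  by (simp_all add: split_type_def)

lemma split_type_cases:
  fixes f :: "'a \<Rightarrow> int"
  assumes "\<And>x. f x = 1 \<or> f x = - 1" "f p0 + f p1 + f p2 + f p3 = 0"
  obtains "split_type (f p0) (f p1) (f p2) = 0" "f p1 = f p0" "f p2 = - f p0" "f p3 = - f p0"
    | "split_type (f p0) (f p1) (f p2) = 1" "f p1 = - f p0" "f p2 = f p0" "f p3 = - f p0"
    | "split_type (f p0) (f p1) (f p2) = 2" "f p1 = - f p0" "f p2 = - f p0" "f p3 = f p0"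
  using assms(1)[of p0] assms(1)[of p1] assms(1)[of p2] assms(1)[of p3] assms(2)
  unfolding split_type_def by (elim disjE) simp_all

text \<open>Two different even splittings of four points multiply to the third one, which is again
  balanced.\<close>

lemma sum_zero_of_split_type_neq:
  fixes f g :: "'a \<Rightarrow> int"
  assumes "\<And>x. f x = 1 \<or> f x = - 1" "\<And>x. g x = 1 \<or> g x = - 1"
    and "f p0 + f p1 + f p2 + f p3 = 0" "g p0 + g p1 + g p2 + g p3 = 0"
    and "split_type (f p0) (f p1) (f p2) \<noteq> split_type (g p0) (g p1) (g p2)"
  shows "f p0 * g p0 + f p1 * g p1 + f p2 * g p2 + f p3 * g p3 = 0"
  by (rule split_type_cases[OF assms(1,3)]; rule split_type_cases[OF assms(2,4)])
    (use assms(5) in simp_all)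

text \<open>Functions with the same even splitting agree on the four points up to a common
  sign.\<close>

lemma constant_of_split_type_eq:
  fixes f g :: "'a \<Rightarrow> int"
  assumes "\<And>x. f x = 1 \<or> f x = - 1" "\<And>x. g x = 1 \<or> g x = - 1"
    and "f p0 + f p1 + f p2 + f p3 = 0" "g p0 + g p1 + g p2 + g p3 = 0"
    and "split_type (f p0) (f p1) (f p2) = split_type (g p0) (g p1) (g p2)"
  shows "\<forall>x\<in>{p0, p1, p2, p3}. f x * g x = f p0 * g p0"
  by (rule split_type_cases[OF assms(1,3)]; rule split_type_cases[OF assms(2,4)])
    (use assms(5) in simp_all)

text \<open>Each \<open>u \<in> P\<close> splits both halves of \<open>E\<close> evenly, and there are 3 classes of pairs of types
  with constant difference modulo 3. Two elements of the same class, distinct modulo \<open>h\<close>, have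
  either equal types on both halves, which puts \<open>E\<close> in a hyperplane, or different types on both
  halves, which makes the transform of \<open>E\<close> vanish at all nonzero combinations of \<open>h\<close> and the two.\<close>

lemma complemented_of_many_zero_pairs:
  fixes E P :: "(bit ^ 'd) set"
  assumes E: "card E = 8" "h \<noteq> 0" "fourier E h = 0"
    and P: "7 \<le> card P" "\<And>u. u \<in> P \<Longrightarrow> fourier E u = 0" "\<And>u. u \<in> P \<Longrightarrow> fourier E (u + h) = 0"
    and generic: "\<And>w c. w \<noteq> 0 \<Longrightarrow> \<not> (\<forall>x\<in>E. chi w x = c)"
  shows "complemented E"
proof -
  note half = card_balanced_half[OF E(1,3)]
  obtain p0 p1 p2 p3 where p: "{e \<in> E. chi h e = 1} = {p0, p1, p2, p3}" "distinct [p0, p1, p2, p3]"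
    using obtain_4_distinct[OF half(1)] by blast
  obtain q0 q1 q2 q3 where q: "{e \<in> E. chi h e = - 1} = {q0, q1, q2, q3}" "distinct [q0, q1, q2, q3]"
    using obtain_4_distinct[OF half(2)] by blast
  define F0 F1 where "F0 u = chi u p0 + chi u p1 + chi u p2 + chi u p3"
    and "F1 u = chi u q0 + chi u q1 + chi u q2 + chi u q3" for u
  have E_eq: "E = {p0, p1, p2, p3} \<union> {q0, q1, q2, q3}" "{p0, p1, p2, p3} \<inter> {q0, q1, q2, q3} = {}"
    unfolding p(1)[symmetric] q(1)[symmetric] using chi_cases by auto
  have hp: "chi h x = 1" if "x \<in> {p0, p1, p2, p3}" for x
    using that unfolding p(1)[symmetric] by simp
  have hq: "chi h x = - 1" if "x \<in> {q0, q1, q2, q3}" for x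
    using that unfolding q(1)[symmetric] by simp
  have F: "fourier E u = F0 u + F1 u" for u
    unfolding fourier_def F0_def F1_def
    by (subst E_eq(1), subst sum.union_disjoint) (use E_eq(2) p(2) q(2) in auto)
  \<comment> \<open>Adding \<open>h\<close> changes the sign on one half only, so the transform
    vanishes at both \<open>u\<close> and \<open>u + h\<close> exactly when both half sums
    vanish.\<close>
  have "F0 (u + h) = F0 u" "F1 (u + h) = - F1 u" for u
    by (simp_all add: F0_def F1_def chi_add_left hp hq)
  then have F_h: "fourier E (u + h) = F0 u - F1 u" for u
    by (simp add: F)
  have F0: "F0 u = 0" and F1: "F1 u = 0" if "u \<in> P" for u
    using P(2,3)[OF that] F[of u] F_h[of u] by linarith+
  define tp where "tp u = split_type (chi u p0) (chi u p1) (chi u p2)" for u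
  define tq where "tq u = split_type (chi u q0) (chi u q1) (chi u q2)" for u
  define \<kappa> where "\<kappa> u = (tq u - tp u) mod 3" for u
  have "\<kappa> u = 0 \<or> \<kappa> u = 1 \<or> \<kappa> u = 2" for u
    unfolding \<kappa>_def by presburger
  then have "P = {u \<in> P. \<kappa> u = 0} \<union> {u \<in> P. \<kappa> u = 1} \<union> {u \<in> P. \<kappa> u = 2}"
    by auto
  then have "card P \<le> card ({u \<in> P. \<kappa> u = 0} \<union> {u \<in> P. \<kappa> u = 1}) + card {u \<in> P. \<kappa> u = 2}"
    using card_Un_le[of "{u \<in> P. \<kappa> u = 0} \<union> {u \<in> P. \<kappa> u = 1}" "{u \<in> P. \<kappa> u = 2}"] by simp
  also have "\<dots> \<le> card {u \<in> P. \<kappa> u = 0} + card {u \<in> P. \<kappa> u = 1} + card {u \<in> P. \<kappa> u = 2}"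
    by (intro add_right_mono card_Un_le)
  \<comment> \<open>Three elements in one class, rather than two, leave a \<open>v\<close> other
    than \<open>u\<close> and \<open>u + h\<close>.\<close>
  finally have "3 \<le> card {u \<in> P. \<kappa> u = 0} \<or> 3 \<le> card {u \<in> P. \<kappa> u = 1} \<or> 3 \<le> card {u \<in> P. \<kappa> u = 2}"
    using P(1) by linarith
  then obtain k where "3 \<le> card {u \<in> P. \<kappa> u = k}"
    by blast
  then obtain u v v' where "u \<in> {u \<in> P. \<kappa> u = k}" "v \<in> {u \<in> P. \<kappa> u = k}" "v' \<in> {u \<in> P. \<kappa> u = k}"
      "u \<noteq> v" "u \<noteq> v'" "v \<noteq> v'"
    by (rule obtain_3_distinct)
  then obtain v where uv: "u \<in> P" "v \<in> P" "\<kappa> u = \<kappa> v" "v \<noteq> u" "v \<noteq> u + h"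
    by (cases "v = u + h") auto
  show ?thesis
  proof (cases "tp u = tp v \<or> tq u = tq v")
    case True
    have "tp u = tp v \<and> tq u = tq v"
    proof -
      have range: "0 \<le> tp x" "tp x \<le> 2" "0 \<le> tq x" "tq x \<le> 2" for x
        by (simp_all add: tp_def tq_def split_type_range)
      \<comment> \<open>Types differ by at most 2, so the congruence modulo 3 carries equality of
        types from one half to the other.\<close>
      have small: "d = 0" if "3 dvd d" "\<bar>d\<bar> \<le> 2" for d :: int
        using that by presburger
      have "3 dvd (tq u - tp u) - (tq v - tp v)"
        using uv(3) unfolding \<kappa>_def by (simp only: mod_eq_dvd_iff)
      from small[OF this] show ?thesis
        using range[of u] range[of v] True by linarith
    qed
    then have types: "split_type (chi u p0) (chi u p1) (chi u p2) = split_type (chi v p0) (chi v p1) (chi v p2)"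
      "split_type (chi u q0) (chi u q1) (chi u q2) = split_type (chi v q0) (chi v q1) (chi v q2)"
      by (simp_all add: tp_def tq_def)
    have cp: "\<forall>x\<in>{p0, p1, p2, p3}. chi (u + v) x = chi (u + v) p0"
      using constant_of_split_type_eq[of "chi u" "chi v" p0 p1 p2 p3] types(1) F0[OF uv(1)] F0[OF uv(2)] chi_cases
      unfolding chi_add_left F0_def by blast
    have cq: "\<forall>x\<in>{q0, q1, q2, q3}. chi (u + v) x = chi (u + v) q0"
      using constant_of_split_type_eq[of "chi u" "chi v" q0 q1 q2 q3] types(2) F1[OF uv(1)] F1[OF uv(2)] chi_cases
      unfolding chi_add_left F1_def by blast
    show ?thesis
    proof (cases "chi (u + v) p0 = chi (u + v) q0")
      case True
      then have "\<forall>x\<in>E. chi (u + v) x = chi (u + v) p0"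
        unfolding E_eq(1) ball_Un using cp cq by (simp only:)
      then show ?thesis
        using generic[of "u + v"] uv(4) by simp
    next
      case False
      \<comment> \<open>Opposite constants on the two halves are reconciled by adding
        \<open>h\<close>.\<close>
      then have "chi (u + v) q0 = - chi (u + v) p0"
        using chi_cases[of "u + v" p0] chi_cases[of "u + v" q0] by auto
      then have "chi (u + v + h) x = chi (u + v) p0" if "x \<in> {q0, q1, q2, q3}" for x
        using bspec[OF cq that] hq[OF that] chi_add_left[of "u + v" h x] by simp
      moreover have "chi (u + v + h) x = chi (u + v) p0" if "x \<in> {p0, p1, p2, p3}" for x
        using bspec[OF cp that] hp[OF that] chi_add_left[of "u + v" h x] by simp
      ultimately have "\<forall>x\<in>E. chi (u + v + h) x = chi (u + v) p0"
        unfolding E_eq(1) by blast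
      moreover have "u + v + h \<noteq> 0"
        using uv(5) by (metis add.assoc add.commute bit_vec_add_eq_0_iff)
      ultimately show ?thesis
        using generic[of "u + v + h"] by blast
    qed
  next
    case False
    have "F0 (u + v) = 0"
      using sum_zero_of_split_type_neq[of "chi u" "chi v" p0 p1 p2 p3] False F0[OF uv(1)] F0[OF uv(2)] chi_cases
      unfolding chi_add_left F0_def tp_def by blast
    moreover have "F1 (u + v) = 0"
      using sum_zero_of_split_type_neq[of "chi u" "chi v" q0 q1 q2 q3] False F1[OF uv(1)] F1[OF uv(2)] chi_cases
      unfolding chi_add_left F1_def tq_def by blast
    ultimately have "fourier E (u + v) = 0" "fourier E (u + v + h) = 0"
      using F[of "u + v"] F_h[of "u + v"] by simp_all
    then show ?thesis
      using P(2,3) uv(1,2) E by (intro complemented_of_three_characters[of E u v h]) simp_all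
  qed
qed

text \<open>Take \<open>h\<close> where the transform off zero has maximal absolute value
  \<open>M\<close>, at most 7. In the convolution identity at \<open>h\<close> the terms
  \<open>0\<close> and \<open>h\<close> supply \<open>16 * fourier A h\<close> out of
  \<open>64 * fourier A h\<close>. The remaining terms must supply \<open>48 * M\<close> in absolute
  value, each at most \<open>M * M\<close>, so there are at least 48 / 7 of them.\<close>

lemma many_pairs_in_support:
  fixes A :: "(bit ^ 'd) set"
  assumes N: "CARD(bit ^ 'd) = 64" "card A = 8"
    and small: "\<And>u. u \<noteq> 0 \<Longrightarrow> \<bar>fourier A u\<bar> \<noteq> 8"
  obtains h where "h \<noteq> 0" "fourier A h \<noteq> 0"
    "7 \<le> card {u. u \<noteq> 0 \<and> u \<noteq> h \<and> fourier A u \<noteq> 0 \<and> fourier A (u + h) \<noteq> 0}"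
proof -
  define M where "M = Max ((\<lambda>u. \<bar>fourier A u\<bar>) ` (UNIV - {0}))"
  have "A \<noteq> UNIV" "A \<noteq> {}"
    using N by auto
  then obtain g where g: "g \<noteq> 0" "fourier A g \<noteq> 0"
    using fourier_vanishing_imp_UNIV by blast
  have le_M: "\<bar>fourier A u\<bar> \<le> M" if "u \<noteq> 0" for u
    unfolding M_def using that by (intro Max_ge) auto
  have "M \<in> (\<lambda>u. \<bar>fourier A u\<bar>) ` (UNIV - {0})"
    unfolding M_def using g by (intro Max_in) auto
  then obtain h where h: "h \<noteq> 0" "\<bar>fourier A h\<bar> = M"
    by blast
  have M: "0 < M" "M \<le> 7"
    using g le_M[OF g(1)] h small[OF h(1)] abs_fourier_le[of A h] N(2) by auto
  define P where "P = {u. u \<noteq> 0 \<and> u \<noteq> h \<and> fourier A u \<noteq> 0 \<and> fourier A (u + h) \<noteq> 0}"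
  have "(\<Sum>u\<in>UNIV. fourier A u * fourier A (u + h)) = (\<Sum>u\<in>{0, h} \<union> P. fourier A u * fourier A (u + h))"
    by (intro sum.mono_neutral_right) (auto simp: P_def)
  also have "\<dots> = (\<Sum>u\<in>{0, h}. fourier A u * fourier A (u + h)) + (\<Sum>u\<in>P. fourier A u * fourier A (u + h))"
    by (intro sum.union_disjoint) (auto simp: P_def)
  also have "(\<Sum>u\<in>{0, h}. fourier A u * fourier A (u + h)) = 16 * fourier A h"
    using h(1) N(2) by simp
  finally have "64 * fourier A h = 16 * fourier A h + (\<Sum>u\<in>P. fourier A u * fourier A (u + h))"
    unfolding fourier_convolution N(1) by simp
  then have "48 * fourier A h = (\<Sum>u\<in>P. fourier A u * fourier A (u + h))"
    by linarith
  then have "48 * M = \<bar>\<Sum>u\<in>P. fourier A u * fourier A (u + h)\<bar>"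
    using h(2) by linarith
  also have "\<dots> \<le> (\<Sum>u\<in>P. \<bar>fourier A u * fourier A (u + h)\<bar>)"
    by (rule sum_abs)
  also have "\<dots> \<le> (\<Sum>u\<in>P. M * M)"
  proof (rule sum_mono)
    fix u assume "u \<in> P"
    then show "\<bar>fourier A u * fourier A (u + h)\<bar> \<le> M * M"
      unfolding abs_mult using M(1) by (intro mult_mono le_M) (auto simp: P_def)
  qed
  also have "\<dots> = (int (card P) * M) * M"
    by simp
  finally have "48 \<le> int (card P) * M"
    using M(1) by simp
  also have "\<dots> \<le> int (card P) * 7"
    using M(2) by (intro mult_left_mono) auto
  finally have "7 \<le> card P"
    by linarith
  then show thesis
    using that[of h] h M(1) by (auto simp: P_def)
qed

lemma complemented_tile_8:
  fixes E A :: "(bit ^ 'd) set"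
  assumes N: "CARD(bit ^ 'd) = 64" "card E = 8" "card A = 8"
    and bij: "bij_betw (\<lambda>(e, a). e + a) (E \<times> A) UNIV"
  shows "complemented E"
proof -
  consider w c where "w \<noteq> 0" "\<forall>x\<in>E. chi w x = c" | w c where "w \<noteq> 0" "\<forall>x\<in>A. chi w x = c"
    | "\<And>w c. w \<noteq> 0 \<Longrightarrow> \<not> (\<forall>x\<in>E. chi w x = c)" "\<And>w c. w \<noteq> 0 \<Longrightarrow> \<not> (\<forall>x\<in>A. chi w x = c)"
    by blast
  then show ?thesis
  proof cases
    case (1 w c)
    then show ?thesis
      by (rule complemented_tile_in_hyperplane[OF N tile_packing[OF bij]])
  next
    case (2 w c)
    then show ?thesis
      by (rule complemented_tile_partner_in_hyperplane[OF N bij])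
  next
    case 3
    \<comment> \<open>Since \<open>A\<close> lies in no hyperplane, the support of its transform
      contains enough pairs, and the transform of \<open>E\<close> vanishes on the nonzero part of
      that support.\<close>
    have "\<bar>fourier A u\<bar> \<noteq> 8" if "u \<noteq> 0" for u
      using constant_chi_of_abs_fourier[of A u] 3(2)[OF that] N(3) by auto
    then obtain h where h: "h \<noteq> 0" "fourier A h \<noteq> 0"
      "7 \<le> card {u. u \<noteq> 0 \<and> u \<noteq> h \<and> fourier A u \<noteq> 0 \<and> fourier A (u + h) \<noteq> 0}"
      by (rule many_pairs_in_support[OF N(1,3)])
    have zero: "fourier E u = 0" if "u \<noteq> 0" "fourier A u \<noteq> 0" for u
      using tile_fourier[OF bij that(1)] that(2) by simp
    show ?thesis
      by (rule complemented_of_many_zero_pairs[OF N(2) h(1) zero[OF h(1,2)] h(3) _ _ 3(1)])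
        (auto intro: zero)
  qed
qed

lemma is_tile_imp_complemented:
  fixes E :: "(bit ^ 'd) set"
  assumes "CARD('d) \<in> {5, 6}" "is_tile E"
  shows "complemented E"
proof -
  let ?N = "CARD(bit ^ 'd)"
  obtain A where bij: "bij_betw (\<lambda>(e, a). e + a) (E \<times> A) UNIV"
    using assms(2) is_tile_iff_bij by blast
  have card: "card E * card A = ?N"
    using bij_betw_same_card[OF bij] by (simp add: card_cartesian_product)
  have N: "?N = 2 ^ CARD('d)"
    by (rule card_bit_vec)
  note in_A = complemented_of_packing[OF tile_packing[OF bij]]
  have "card E dvd 2 ^ CARD('d)"
    using card N by (metis dvd_triv_left)
  then obtain m where m: "m \<le> CARD('d)" "card E = 2 ^ m"
    using divides_primepow_nat[OF two_is_prime_nat] by blast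
  then have "2 ^ m * card A = 2 ^ m * 2 ^ (CARD('d) - m)"
    using card N by (simp flip: power_add)
  then have A: "card A = 2 ^ (CARD('d) - m)"
    by simp
  \<comment> \<open>In dimension 5 the first four cases exhaust all \<open>m\<close>; in dimension 6
    only two sets of order 8 remain.\<close>
  consider "m \<le> 2" | "m = CARD('d)" | "m + 1 = CARD('d)" | "m + 2 = CARD('d)" | "m = 3" "CARD('d) = 6"
    using m(1) assms(1) by force
  then show ?thesis
  proof cases
    case 1
    then show ?thesis
      using complemented_card_le_4 m by blast
  next
    case 2
    then show ?thesis
      using m N by (intro complementedI[of "{0}"]) (auto simp: subgp_def)
  next
    case 3
    then have "card A = 2"
      using A by (metis add_diff_cancel_left' power_one_right)
    then obtain p q where pq: "A = {p, q}" "p \<noteq> q"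
      by (auto simp: card_2_iff)
    show ?thesis
    proof (rule in_A[of "{0, p + q}"])
      show "subgp {0, p + q}"
        by (simp add: subgp_def)
      show "{0, p + q} \<subseteq> sumset A"
        unfolding pq sumset_def by (auto intro: exI[of _ p])
      show "?N \<le> card E * card {0, p + q}"
        using pq \<open>card A = 2\<close> card by simp
    qed
  next
    case 4
    then have "card A = 4"
      using A by (metis add_diff_cancel_left' numeral_Bit0_eq_double power2_eq_square mult_2)
    then obtain p q r where pqr: "p \<in> A" "q \<in> A" "r \<in> A" "p \<noteq> q" "p \<noteq> r" "q \<noteq> r"
      using obtain_3_distinct[of A] by auto
    then show ?thesis
      using in_A[of "{0, p + q, p + r, q + r}"] subgp_of_three_points[of p q r] subset_sumset_of_three_points[of p A q r]
        \<open>card A = 4\<close> card by simp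
  next
    case 5
    then show ?thesis
      using complemented_tile_8[OF _ _ _ bij] m A N by simp
  qed
qed

theorem mainTheorem1:
  fixes E :: "(bit ^ 'd) set"
  assumes "CARD('d) \<in> {5, 6}"
    and "E \<noteq> {}"
  shows "spectral E \<longleftrightarrow> is_tile E"
  using assms spectral_imp_complemented is_tile_imp_complemented
    complemented_imp_spectral complemented_imp_is_tile by blast

end
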